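(* Let $X$ be a complex Banach space with $\dim X<\infty$, $A\in L(X)$, $\omega>0$, $c\in\mathbb{C}\setminus\{0\}$, and suppose that $c\neq e^{\omega\lambda}$ for all $\lambda\in\sigma(A)$. Let $g\in C(\mathbb{R}\times X,X)$ satisfy (i) $g(t+\omega,cy)=cg(t,y)$ for all $t\in\mathbb{R}$ and $y\in X$; (ii) there are constants $g_1\ge0$ and $g_2\ge0$ such that $\|g(t,y)\|\le g_1+g_2\|y\|$ for all $t\in\mathbb{R}$ and $y\in X$. Let $M=\max_{t\in[0,\omega]}\int_0^\omega\|K(t,s)\|\,ds$. If $g_2M<1$, then the equation $\dot y=Ay+g(t,y)$ has an $(\omega,c)$-periodic solution $y:\mathbb{R}\to X$ with $$\|y\|_0\le\frac{Mg_1}{1-Mg_2}.$$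
   Context: A function $y:\mathbb{R}\to X$ is $(\omega,c)$-periodic if $y(t+\omega)=cy(t)$ for all $t\in\mathbb{R}$. $\|y\|_0=\max_{t\in[0,\omega]}\|y(t)\|$. $\sigma(A)$ is the spectrum of $A$ and $I$ is the identity on $X$. The assumption on $c$ means $c\notin\sigma(e^{A\omega})$, so $cI-e^{A\omega}$ is invertible, and the kernel $K$ is defined for $t,s\in[0,\omega]$ by $$K(t,s)=\begin{cases}c\,e^{A(t-s)}(cI-e^{A\omega})^{-1}&\text{for } s\in[0,t],\\ e^{A(\omega+t-s)}(cI-e^{A\omega})^{-1}&\text{for } s\in(t,\omega].\end{cases}$$ *)

theory Defs
  imports "HOL-Analysis.Analysis"
begin

section \<open>Complex Banach spaces\<close>

text \<open>
  The distribution only has real normed spaces. A complex normed space is a real one together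
  with a complex scalar multiplication that extends the real one; \<^class>\<open>banach\<close> adds
  completeness.
\<close>

class complex_normed_vector = real_normed_vector +
  fixes scaleC :: "complex \<Rightarrow> 'a \<Rightarrow> 'a" (infixr \<open>*\<^sub>C\<close> 75)
  assumes scaleC_add_right: "z *\<^sub>C (x + y) = z *\<^sub>C x + z *\<^sub>C y"
    and scaleC_add_left: "(z + w) *\<^sub>C x = z *\<^sub>C x + w *\<^sub>C x"
    and scaleC_scaleC: "z *\<^sub>C w *\<^sub>C x = (z * w) *\<^sub>C x"
    and scaleC_one: "1 *\<^sub>C x = x"
    and scaleC_of_real: "complex_of_real r *\<^sub>C x = r *\<^sub>R x"
    and norm_scaleC: "norm (z *\<^sub>C x) = cmod z * norm x"

class complex_banach = complex_normed_vector + banach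

global_interpretation complex_vector:
  vector_space "scaleC :: complex \<Rightarrow> 'a \<Rightarrow> 'a::complex_normed_vector"
  by unfold_locales (simp_all add: scaleC_add_right scaleC_add_left scaleC_scaleC scaleC_one)

definition finite_cdim :: "'a::complex_normed_vector itself \<Rightarrow> bool" where
  "finite_cdim _ \<longleftrightarrow> (\<exists>B :: 'a set. finite B \<and> complex_vector.span B = UNIV)"

instantiation complex :: complex_banach
begin

definition scaleC_complex :: "complex \<Rightarrow> complex \<Rightarrow> complex" where
  "scaleC_complex z x = z * x"

instance
  by intro_classes (simp_all add: scaleC_complex_def algebra_simps norm_mult scaleR_conv_of_real)

end

lemma bounded_linear_scaleC: "bounded_linear (\<lambda>x :: 'a::complex_normed_vector. z *\<^sub>C x)"
proof (rule bounded_linear_intro[where K = "cmod z"])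
  fix r and x :: 'a
  have "z *\<^sub>C r *\<^sub>R x = (z * complex_of_real r) *\<^sub>C x"
    by (simp only: scaleC_of_real[symmetric] scaleC_scaleC)
  also have "\<dots> = r *\<^sub>R z *\<^sub>C x"
    by (simp only: scaleC_of_real[symmetric] scaleC_scaleC mult.commute)
  finally show "z *\<^sub>C r *\<^sub>R x = r *\<^sub>R z *\<^sub>C x" .
qed (simp_all add: scaleC_add_right norm_scaleC mult.commute)

section \<open>Bounded operators\<close>

instantiation blinfun :: (real_normed_vector, complex_normed_vector) complex_normed_vector
begin

lift_definition scaleC_blinfun :: "complex \<Rightarrow> ('a \<Rightarrow>\<^sub>L 'b) \<Rightarrow> ('a \<Rightarrow>\<^sub>L 'b)"
  is "\<lambda>z f x. z *\<^sub>C f x"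
  by (rule bounded_linear_compose[OF bounded_linear_scaleC])

instance
proof
  fix z w :: complex and f g :: "'a \<Rightarrow>\<^sub>L 'b" and r :: real
  show "z *\<^sub>C (f + g) = z *\<^sub>C f + z *\<^sub>C g"
    by transfer (simp add: scaleC_add_right)
  show "(z + w) *\<^sub>C f = z *\<^sub>C f + w *\<^sub>C f"
    by transfer (simp add: scaleC_add_left)
  show "z *\<^sub>C w *\<^sub>C f = (z * w) *\<^sub>C f"
    by transfer (simp add: scaleC_scaleC)
  show "1 *\<^sub>C f = f"
    by transfer (simp add: scaleC_one)
  show "complex_of_real r *\<^sub>C f = r *\<^sub>R f"
    by transfer (simp add: scaleC_of_real)
  show "norm (z *\<^sub>C f) = cmod z * norm f"
  proof transfer
    fix z and f :: "'a \<Rightarrow> 'b"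
    assume f: "bounded_linear f"
    let ?h = "\<lambda>x. z *\<^sub>C f x"
    have h: "bounded_linear ?h"
      by (rule bounded_linear_compose[OF bounded_linear_scaleC f])
    have "onorm ?h \<le> cmod z * onorm f"
    proof (rule onorm_bound)
      show "0 \<le> cmod z * onorm f"
        by (simp add: onorm_pos_le[OF f])
      show "norm (z *\<^sub>C f x) \<le> cmod z * onorm f * norm x" for x
        using mult_left_mono[OF onorm[OF f, of x], of "cmod z"] by (simp add: norm_scaleC mult.assoc)
    qed
    moreover have "cmod z * onorm f \<le> onorm ?h"
    proof (cases "z = 0")
      case True
      then show ?thesis
        by (simp add: onorm_zero)
    next
      case False
      have "onorm f \<le> onorm ?h / cmod z"
      proof (rule onorm_bound)
        show "0 \<le> onorm ?h / cmod z"
          by (simp add: onorm_pos_le[OF h])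
        show "norm (f x) \<le> onorm ?h / cmod z * norm x" for x
          using onorm[OF h, of x] False by (simp add: norm_scaleC field_simps)
      qed
      then show ?thesis
        using False by (simp add: field_simps)
    qed
    ultimately show "onorm ?h = cmod z * onorm f"
      by simp
  qed
qed

end

text \<open>
  \<open>'a \<Rightarrow>\<^sub>L 'a\<close> consists of the real-linear bounded operators; \<open>L(X)\<close> is the subset of the
  complex-linear ones, with the same operator norm.
\<close>

definition complex_operators :: "('a::complex_normed_vector \<Rightarrow>\<^sub>L 'a) set" where
  "complex_operators = {T. Vector_Spaces.linear scaleC scaleC (blinfun_apply T)}"

definition op_spectrum :: "('a::complex_normed_vector \<Rightarrow>\<^sub>L 'a) \<Rightarrow> complex set" where
  "op_spectrum T = {z. \<not> (\<exists>S \<in> complex_operators.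
     S o\<^sub>L (z *\<^sub>C id_blinfun - T) = id_blinfun \<and> (z *\<^sub>C id_blinfun - T) o\<^sub>L S = id_blinfun)}"

definition op_inverse :: "('a::real_normed_vector \<Rightarrow>\<^sub>L 'a) \<Rightarrow> ('a \<Rightarrow>\<^sub>L 'a)" where
  "op_inverse T = (THE S. S o\<^sub>L T = id_blinfun \<and> T o\<^sub>L S = id_blinfun)"

text \<open>
  The library function \<^const>\<open>exp\<close> does not apply to \<open>'a \<Rightarrow>\<^sub>L 'a\<close>, which is not an instance of
  \<^class>\<open>real_normed_algebra_1\<close> (the zero space violates \<open>0 \<noteq> 1\<close>). The series converges in
  operator norm.
\<close>

definition op_exp :: "('a::banach \<Rightarrow>\<^sub>L 'a) \<Rightarrow> ('a \<Rightarrow>\<^sub>L 'a)" where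
  "op_exp T = (\<Sum>n. ((\<lambda>S. T o\<^sub>L S) ^^ n) id_blinfun /\<^sub>R fact n)"

section \<open>Periodic functions and the kernel\<close>

definition omega_c_periodic :: "real \<Rightarrow> complex \<Rightarrow> (real \<Rightarrow> 'a::complex_normed_vector) \<Rightarrow> bool" where
  "omega_c_periodic \<omega> c y \<longleftrightarrow> (\<forall>t. y (t + \<omega>) = c *\<^sub>C y t)"

text \<open>A genuine maximum: meaningful only if the values of \<open>f\<close> on \<open>S\<close> have a greatest element.\<close>

definition max_on :: "'b set \<Rightarrow> ('b \<Rightarrow> real) \<Rightarrow> real" where
  "max_on S f = (GREATEST v. v \<in> f ` S)"

definition norm0 :: "real \<Rightarrow> (real \<Rightarrow> 'a::real_normed_vector) \<Rightarrow> real" where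
  "norm0 \<omega> y = max_on {0..\<omega>} (\<lambda>t. norm (y t))"

text \<open>Only used for \<open>t, s \<in> [0, \<omega>]\<close>.\<close>

definition kernel_K ::
  "('a::complex_banach \<Rightarrow>\<^sub>L 'a) \<Rightarrow> real \<Rightarrow> complex \<Rightarrow> real \<Rightarrow> real \<Rightarrow> ('a \<Rightarrow>\<^sub>L 'a)" where
  "kernel_K A \<omega> c t s =
    (if s \<le> t
     then c *\<^sub>C (op_exp ((t - s) *\<^sub>R A) o\<^sub>L op_inverse (c *\<^sub>C id_blinfun - op_exp (\<omega> *\<^sub>R A)))
     else op_exp ((\<omega> + t - s) *\<^sub>R A) o\<^sub>L op_inverse (c *\<^sub>C id_blinfun - op_exp (\<omega> *\<^sub>R A)))"

definition kernel_M :: "('a::complex_banach \<Rightarrow>\<^sub>L 'a) \<Rightarrow> real \<Rightarrow> complex \<Rightarrow> real" where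
  "kernel_M A \<omega> c = max_on {0..\<omega>} (\<lambda>t. integral {0..\<omega>} (\<lambda>s. norm (kernel_K A \<omega> c t s)))"

end

(*
The periodic solutions are the fixed points of (T y)(t) = int_0^w K(t,s) g(s, y(s)) ds on C([0,w], X):
writing e^{A(t-s)} = e^{At} e^{-As} turns the right-hand side into e^{At} times an antiderivative, so
T y solves the inhomogeneous equation with (T y)(w) = c (T y)(0). The number R = M g1 / (1 - M g2)
satisfies M (g1 + g2 R) = R, hence T maps the functions bounded by R, with Lipschitz constant
|A| R + g1 + g2 R, into themselves. This set is convex and, X being finite-dimensional, compact, and
Schauder's theorem applies. The fixed point extends from [0,w] to the line by y(t + w) = c y(t).
The operator cI - e^{Aw} is injective, since A would have an eigenvector in its A-invariant kernel.
*)

theory Submission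
  imports Defs "HOL-Computational_Algebra.Fundamental_Theorem_Algebra"
begin

section \<open>Schauder's fixed point theorem\<close>

text \<open>A ball in C([0, \<omega>], X) is in general not compact, even for finite-dimensional X.
  The missing equicontinuity comes from the equation: T y has derivative A (T y) + g(t, y), and the
  bound on this uses only that y and T y are bounded by R, so the Lipschitz constant of T y does not
  depend on that of y.

  At s = t the two branches of the kernel differ by (c I - e^{A\<omega>}) V = I, where V is the
  inverse of c I - e^{A\<omega>}; differentiating the integral turns this difference into the
  inhomogeneous term.

  An eigenvector of A for \<mu> is one of e^{A\<omega>} for e^{\<omega>\<mu>}. If c I -
  e^{A\<omega>} annihilates it, then c = e^{\<omega>\<mu>} with \<mu> in the spectrum of A, which is
  excluded.

  The extension is delicate only at the multiples of \<omega>: the left derivative there is a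
  translate of the one at the end of the base interval, and (i) makes it agree with the right
  derivative.\<close>

lemma compact_PiE_UNIV:
  fixes C :: "'i \<Rightarrow> 'b::topological_space set"
  assumes "\<And>i. compact (C i)"
  shows "compact (PiE UNIV C)"
  using assms compactin_PiE[of "\<lambda>_. euclidean" UNIV C]
  by (simp add: euclidean_product_topology)

text \<open>Freezing the coordinates from \<open>n\<close> on at 0 keeps one type for all
  dimensions, and Tychonoff's theorem gives compactness.\<close>

definition unit_cube :: "nat \<Rightarrow> (nat \<Rightarrow> real) set" where
  "unit_cube n = PiE UNIV (\<lambda>i. if i < n then {0..1} else {0})"

lemma mem_unit_cube: "x \<in> unit_cube n \<longleftrightarrow> (\<forall>i<n. 0 \<le> x i \<and> x i \<le> 1) \<and> (\<forall>i\<ge>n. x i = 0)"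
proof -
  have "x i \<in> (if i < n then {0..1} else {0}) \<longleftrightarrow> (i < n \<longrightarrow> 0 \<le> x i \<and> x i \<le> 1) \<and> (i \<ge> n \<longrightarrow> x i = 0)" for i
    by auto
  then show ?thesis
    by (simp add: unit_cube_def PiE_iff) blast
qed

lemma compact_unit_cube: "compact (unit_cube n)"
  unfolding unit_cube_def by (rule compact_PiE_UNIV) auto

text \<open>The metric on functions sums truncated coordinate distances with the weights 1, 1/2,
  1/4, ..., whose total is the factor 2.\<close>

lemma dist_fun_le:
  fixes x y :: "nat \<Rightarrow> 'b::metric_space"
  assumes "\<And>i. dist (x i) (y i) \<le> d"
  shows "dist x y \<le> 2 * d"
proof -
  have s: "summable (\<lambda>n. (1/2::real) ^ n)"
    by (rule summable_geometric) simp
  have "dist x y \<le> (\<Sum>n. (1/2) ^ n * d)"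
    unfolding dist_fun_def
  proof (rule suminf_le)
    show "summable (\<lambda>n. (1/2) ^ n * d)"
      using s by (rule summable_mult2)
    show "summable (\<lambda>n. (1 / 2) ^ n * min (dist (x (from_nat n)) (y (from_nat n))) 1)"
      by (rule summable_comparison_test'[OF s, of 0]) (auto simp: mult_left_le)
    show "(1 / 2) ^ n * min (dist (x (from_nat n)) (y (from_nat n))) 1 \<le> (1 / 2) ^ n * d" for n
      using assms[of "from_nat n"] by (intro mult_left_mono) auto
  qed
  also have "\<dots> = 2 * d"
    using suminf_mult2[OF s, of d] suminf_geometric[of "1/2::real"] by simp
  finally show ?thesis .
qed

text \<open>Kuhn's combinatorial lemma, on the grid of mesh \<open>1 / p\<close>. Grid points take the place of the
  Euclidean types of the library, whose dimension cannot vary inside a proof.\<close>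

lemma unit_cube_approximate_fixpoint:
  assumes cont: "continuous_on (unit_cube n) f"
    and maps: "\<And>x. x \<in> unit_cube n \<Longrightarrow> f x \<in> unit_cube n"
    and "e > 0"
  obtains x where "x \<in> unit_cube n" "\<And>i. i < n \<Longrightarrow> \<bar>f x i - x i\<bar> < e"
proof -
  have "uniformly_continuous_on (unit_cube n) (\<lambda>x. f x i)" for i
    by (rule compact_uniformly_continuous[OF continuous_on_product_then_coordinatewise[OF cont] compact_unit_cube])
  then have "\<exists>d>0. \<forall>x\<in>unit_cube n. \<forall>y\<in>unit_cube n. dist x y < d \<longrightarrow> \<bar>f x i - f y i\<bar> < e/2" for i
    using \<open>e > 0\<close> unfolding uniformly_continuous_on_def dist_real_def
    by (metis abs_minus_commute dist_commute half_gt_zero)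
  then obtain D where D: "\<And>i. D i > 0"
    "\<And>i x y. x \<in> unit_cube n \<Longrightarrow> y \<in> unit_cube n \<Longrightarrow> dist x y < D i \<Longrightarrow> \<bar>f x i - f y i\<bar> < e/2"
    by metis
  \<comment> \<open>Having \<open>e\<close> in the minimum covers \<open>n = 0\<close> and bounds
    the mesh \<open>1 / p\<close> by \<open>e / 2\<close> later on.\<close>
  define d where "d = Min (insert e (D ` {..<n}))"
  have d: "d > 0" "d \<le> e" "\<And>i. i < n \<Longrightarrow> d \<le> D i"
    using D \<open>e > 0\<close> by (auto simp: d_def)
  obtain p :: nat where p: "p > 0" "2 / d < p"
    by (metis d(1) divide_pos_pos less_numeral_extra(3) of_nat_0_less_iff reals_Archimedean2 order.strict_trans zero_less_numeral)
  have p': "2 * (1 / real p) < d"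
    using p d by (simp add: field_simps)
  define h where "h q = (\<lambda>i. if i < n then real (q i) / p else 0)" for q :: "nat \<Rightarrow> nat"
  \<comment> \<open>Label 0 means that \<open>f\<close> does not decrease coordinate
    \<open>i\<close>. On the face \<open>q i = p\<close> the coordinate is 1 and cannot increase, so
    label 1, which Kuhn's lemma demands there, still stands for a decrease in the weak
    sense.\<close>
  define lab where "lab q i = (if h q i \<le> f (h q) i \<and> q i \<noteq> p then 0 else 1 :: nat)" for q i
  have h: "h q \<in> unit_cube n" if "\<forall>i<n. q i \<le> p" for q
    using that p by (auto simp: mem_unit_cube h_def)
  have lab_01: "\<forall>x. (\<forall>i<n. x i \<le> p) \<longrightarrow> (\<forall>i<n. lab x i = 0 \<or> lab x i = 1)"
    by (simp add: lab_def)
  have lab_low: "\<forall>x. (\<forall>i<n. x i \<le> p) \<longrightarrow> (\<forall>i<n. x i = 0 \<longrightarrow> lab x i = 0)"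
  proof (intro allI impI)
    fix x i assume "\<forall>i<n. x i \<le> p" "i < n" "x i = 0"
    moreover from this have "0 \<le> f (h x) i"
      using maps[OF h, of x] by (auto simp: mem_unit_cube)
    ultimately show "lab x i = 0"
      using p by (auto simp: lab_def h_def)
  qed
  have lab_high: "\<forall>x. (\<forall>i<n. x i \<le> p) \<longrightarrow> (\<forall>i<n. x i = p \<longrightarrow> lab x i = 1)"
    by (simp add: lab_def)
  obtain q where q: "\<forall>i<n. q i < p"
    and rs: "\<forall>i<n. \<exists>r s. (\<forall>j<n. q j \<le> r j \<and> r j \<le> q j + 1) \<and>
      (\<forall>j<n. q j \<le> s j \<and> s j \<le> q j + 1) \<and> lab r i \<noteq> lab s i"
    by (rule kuhn_lemma[OF p(1) lab_01 lab_low lab_high])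
  have hq: "h q \<in> unit_cube n"
    using q by (intro h) (auto simp: less_imp_le)
  have "\<bar>f (h q) i - h q i\<bar> < e" if "i < n" for i
  proof -
    have near: "h r \<in> unit_cube n \<and> h q i \<le> h r i \<and> h r i \<le> h q i + 1 / p \<and> \<bar>f (h q) i - f (h r) i\<bar> < e/2"
      if r: "\<forall>j<n. q j \<le> r j \<and> r j \<le> q j + 1" for r
    proof -
      have r': "h r \<in> unit_cube n"
        using r q by (intro h) (metis Suc_eq_plus1 Suc_leI order_trans)
      have *: "h q j \<le> h r j \<and> h r j \<le> h q j + 1 / p" if "j < n" for j
      proof -
        have "r j \<le> q j + 1"
          using r that by blast
        then have "real (r j) \<le> real (q j) + 1"
          by linarith
        then show ?thesis
          using r p that by (auto simp: h_def divide_right_mono simp flip: add_divide_distrib)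
      qed
      have "dist (h q j) (h r j) \<le> 1 / p" for j
        using *[of j] p by (cases "j < n") (auto simp: dist_real_def h_def)
      then have "dist (h q) (h r) < D i"
        using dist_fun_le[of "h q" "h r" "1 / p"] p' d(3)[OF \<open>i < n\<close>] by simp
      then show ?thesis
        using * \<open>i < n\<close> D(2)[OF hq r'] r' by auto
    qed
    have e: "1 / real p < e / 2"
      using p' d by simp
    have lab0: "h r i \<le> f (h r) i" if "lab r i = 0" for r
      using that by (auto simp: lab_def split: if_splits)
    have lab1: "f (h r) i \<le> h r i" if "lab r i \<noteq> 0" "h r \<in> unit_cube n" for r
      using that maps[OF that(2)] \<open>i < n\<close> p by (auto simp: lab_def h_def mem_unit_cube split: if_splits)
    \<comment> \<open>One of the two vertices bounds the displacement in coordinate \<open>i\<close>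
      from below and the other from above. Moving from them to \<open>q\<close> costs less than
      \<open>e / 2\<close> in the value of \<open>f\<close> and at most \<open>1 / p\<close> in the
      coordinate.\<close>
    obtain r s where r: "\<forall>j<n. q j \<le> r j \<and> r j \<le> q j + 1" and s: "\<forall>j<n. q j \<le> s j \<and> s j \<le> q j + 1"
      and ne: "lab r i \<noteq> lab s i"
      using rs \<open>i < n\<close> by blast
    show ?thesis
    proof (cases "lab r i = 0")
      case True
      then show ?thesis
        using near[OF r] near[OF s] lab0[of r] lab1[of s] ne e by linarith
    next
      case False
      then have "lab s i = 0"
        using ne by (auto simp: lab_def split: if_splits)
      then show ?thesis
        using near[OF r] near[OF s] lab0[of s] lab1[of r] False e by linarith
    qed
  qed
  then show thesis
    by (rule that[OF hq])
qed

text \<open>The Schauder projection onto the convex hull of a finite \<open>e\<close>-net turns \<open>T\<close> into a map of a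
  simplex.\<close>

lemma Schauder_approximate_fixpoint:
  fixes S :: "'a::real_normed_vector set"
  assumes "compact S" "convex S" "S \<noteq> {}"
    and contT: "continuous_on S T" and maps: "\<And>x. x \<in> S \<Longrightarrow> T x \<in> S" and "e > 0"
  obtains x where "x \<in> S" "dist (T x) x \<le> 2 * e"
proof -
  have "S \<subseteq> (\<Union>x\<in>S. ball x e)"
    using \<open>e > 0\<close> centre_in_ball by blast
  then obtain P where P: "P \<subseteq> S" "finite P" "S \<subseteq> (\<Union>x\<in>P. ball x e)"
    using compactE_image[OF \<open>compact S\<close>, of S "\<lambda>x. ball x e"] by blast
  define n where "n = card P"
  obtain p where p: "bij_betw p {0..<n} P"
    using ex_bij_betw_nat_finite P(2) n_def by blast
  have pS: "p i \<in> S" if "i < n" for i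
    using p P that by (auto simp: bij_betw_def)
  have cover: "\<exists>i<n. dist x (p i) < e" if "x \<in> S" for x
    using that P(3) p by (force simp: bij_betw_def dist_commute)
  have n: "n > 0"
    using cover \<open>S \<noteq> {}\<close> by fastforce
  obtain B where B: "B > 0" "\<And>x. x \<in> S \<Longrightarrow> norm x \<le> B"
    using compact_imp_bounded[OF \<open>compact S\<close>] bounded_pos by blast
  define w where "w i x = max 0 (e - dist x (p i))" for i x
  define W where "W x = (\<Sum>i<n. w i x)" for x
  have w0: "0 \<le> w i x" for i x
    by (simp add: w_def)
  have W: "W x > 0" if x: "x \<in> S" for x
  proof -
    obtain i where "i < n" "dist x (p i) < e"
      using cover x by blast
    then show ?thesis
      unfolding W_def by (intro sum_pos2[of _ i]) (auto simp: w_def)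
  qed
  define a where "a x i = (if i < n then w i x / W x else 0)" for x i
  have a0: "0 \<le> a x i" if "x \<in> S" for x i
    using W[OF that] w0 by (auto simp: a_def)
  have asum: "(\<Sum>i<n. a x i) = 1" if "x \<in> S" for x
    using W[OF that] by (simp add: a_def W_def flip: sum_divide_distrib)
  have contw: "continuous_on S (\<lambda>x. a x i)" for i
    unfolding a_def w_def W_def
    by (cases "i < n") (use W in \<open>force intro!: continuous_intros simp: w_def W_def\<close>)+
  \<comment> \<open>Only net points closer than \<open>e\<close> to \<open>x\<close> carry positive
    weight.\<close>
  have near: "norm (x - (\<Sum>i<n. a x i *\<^sub>R p i)) \<le> e" if "x \<in> S" for x
  proof -
    have "x - (\<Sum>i<n. a x i *\<^sub>R p i) = (\<Sum>i<n. a x i *\<^sub>R (x - p i))"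
      using asum[OF that] by (simp add: scaleR_diff_right sum_subtractf flip: scaleR_sum_left)
    also have "norm \<dots> \<le> (\<Sum>i<n. a x i * e)"
    proof (rule sum_norm_le)
      fix i assume "i \<in> {..<n}"
      show "norm (a x i *\<^sub>R (x - p i)) \<le> a x i * e"
      proof (cases "dist x (p i) \<le> e")
        case True
        then show ?thesis
          using a0[OF that, of i] by (simp add: dist_norm mult_left_mono)
      next
        case False
        then show ?thesis
          by (simp add: a_def w_def)
      qed
    qed
    also have "\<dots> = e"
      using asum[OF that] by (simp flip: sum_distrib_right)
    finally show ?thesis .
  qed
  define \<sigma> where "\<sigma> x = (\<Sum>i<n. x i)" for x :: "nat \<Rightarrow> real"
  \<comment> \<open>a retraction of the cube onto the standard simplex\<close>
  define r where "r x i = (x i + max 0 (1 - \<sigma> x) / n) / max 1 (\<sigma> x)" for x i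
  have contr: "continuous_on (unit_cube n) (\<lambda>x. r x i)" for i
    unfolding r_def \<sigma>_def
    by (intro continuous_intros continuous_on_subset[OF continuous_on_product_coordinates]) (use n in auto)
  have r0: "0 \<le> r x i" if "x \<in> unit_cube n" for x i
  proof -
    have "0 \<le> x i"
      using that by (cases "i < n") (auto simp: mem_unit_cube)
    then show ?thesis
      by (auto simp: r_def)
  qed
  have rsum: "(\<Sum>i<n. r x i) = 1" for x
  proof -
    have "(\<Sum>i<n. r x i) = (\<sigma> x + max 0 (1 - \<sigma> x)) / max 1 (\<sigma> x)"
      using n by (simp add: r_def sum.distrib \<sigma>_def flip: sum_divide_distrib)
    then show ?thesis
      by (auto simp: max_def)
  qed
  define Y where "Y x = (\<Sum>i<n. r x i *\<^sub>R p i)" for x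
  have Y: "Y x \<in> S" if "x \<in> unit_cube n" for x
    unfolding Y_def using \<open>convex S\<close> rsum r0[OF that] pS by (intro convex_sum) auto
  have contY: "continuous_on (unit_cube n) Y"
    unfolding Y_def by (intro continuous_intros contr)
  \<comment> \<open>Each coefficient will be off by at most \<open>(n + 1) * \<eta>\<close>:
    \<open>n * \<eta>\<close> from the retraction and \<open>\<eta>\<close> from the approximate
    fixed point. Summed over \<open>n\<close> points of norm at most \<open>B\<close> this gives
    \<open>e\<close>.\<close>
  define \<eta> where "\<eta> = e / (real n * real (n + 1) * B)"
  have \<eta>: "\<eta> > 0"
    using n B(1) \<open>e > 0\<close> unfolding \<eta>_def by (intro divide_pos_pos mult_pos_pos) auto
  \<comment> \<open>The map on the cube decodes coordinates to a point of \<open>S\<close>, applies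
    \<open>T\<close>, and reads off the weights of the Schauder projection.\<close>
  obtain x where x: "x \<in> unit_cube n" and fx: "\<And>i. i < n \<Longrightarrow> \<bar>a (T (Y x)) i - x i\<bar> < \<eta>"
  proof (rule unit_cube_approximate_fixpoint[of n "\<lambda>x. a (T (Y x))" \<eta>])
    have "continuous_on (unit_cube n) (\<lambda>x. T (Y x))"
      using continuous_on_compose2[OF contT contY] Y by blast
    then have "continuous_on (unit_cube n) (\<lambda>x. a (T (Y x)) i)" for i
      using continuous_on_compose2[OF contw] Y maps by blast
    then show "continuous_on (unit_cube n) (\<lambda>x. a (T (Y x)))"
      by (rule continuous_on_coordinatewise_then_product)
    show "a (T (Y x)) \<in> unit_cube n" if "x \<in> unit_cube n" for x
    proof -
      have S: "T (Y x) \<in> S"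
        using Y maps that by blast
      have "a (T (Y x)) i \<le> 1" if "i < n" for i
        using member_le_sum[of i "{..<n}" "a (T (Y x))"] asum[OF S] a0[OF S] that by auto
      moreover have "a (T (Y x)) i = 0" if "n \<le> i" for i
        using that by (simp add: a_def)
      ultimately show ?thesis
        using a0[OF S] by (simp add: mem_unit_cube)
    qed
  qed (use \<eta> in auto)
  define b where "b = a (T (Y x))"
  have S: "T (Y x) \<in> S"
    using Y maps x by blast
  \<comment> \<open>\<open>x\<close> itself need not lie on the simplex, but it is coordinatewise
    close to \<open>b\<close>, whose coordinates sum to 1; hence the retraction hardly moves
    it.\<close>
  have "\<bar>\<sigma> x - 1\<bar> \<le> (\<Sum>i<n. \<bar>x i - b i\<bar>)"
    using asum[OF S] sum_abs[of "\<lambda>i. x i - b i" "{..<n}"] by (simp add: \<sigma>_def b_def sum_subtractf)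
  also have "\<dots> \<le> (\<Sum>i<n. \<eta>)"
    using fx by (intro sum_mono) (auto simp: b_def abs_minus_commute less_imp_le)
  finally have \<sigma>: "\<bar>\<sigma> x - 1\<bar> \<le> n * \<eta>"
    by simp
  have rx: "\<bar>r x i - x i\<bar> \<le> n * \<eta>" if "i < n" for i
  proof (cases "\<sigma> x \<le> 1")
    case True
    then have "\<bar>r x i - x i\<bar> = (1 - \<sigma> x) / n"
      by (simp add: r_def)
    also have "\<dots> \<le> (1 - \<sigma> x) / 1"
      using True n by (intro divide_left_mono) auto
    finally show ?thesis
      using \<sigma> by auto
  next
    case False
    have xi: "0 \<le> x i" "x i \<le> 1"
      using x that by (auto simp: mem_unit_cube)
    define k where "k = x i * ((\<sigma> x - 1) / \<sigma> x)"
    have "x i - r x i = k"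
      using False by (simp add: r_def k_def field_simps)
    moreover have "k \<le> 1 * ((\<sigma> x - 1) / 1)"
      unfolding k_def using xi False by (intro mult_mono divide_left_mono) auto
    moreover have "0 \<le> k"
      using xi False by (auto simp: k_def)
    ultimately have "\<bar>r x i - x i\<bar> \<le> \<sigma> x - 1"
      by simp
    also have "\<dots> \<le> n * \<eta>"
      using \<sigma> False by simp
    finally show ?thesis .
  qed
  have "Y x - (\<Sum>i<n. b i *\<^sub>R p i) = (\<Sum>i<n. (r x i - b i) *\<^sub>R p i)"
    by (simp add: Y_def scaleR_diff_left sum_subtractf)
  also have "norm \<dots> \<le> (\<Sum>i<n. ((n + 1) * \<eta>) * B)"
  proof (rule sum_norm_le)
    fix i assume "i \<in> {..<n}"
    then have "\<bar>r x i - b i\<bar> \<le> (n + 1) * \<eta>" "norm (p i) \<le> B"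
      using rx[of i] fx[of i] B pS by (auto simp: b_def algebra_simps)
    then show "norm ((r x i - b i) *\<^sub>R p i) \<le> ((n + 1) * \<eta>) * B"
      using \<eta> by (auto intro!: mult_mono)
  qed
  also have "\<dots> = e"
    using n B by (simp add: \<eta>_def)
  finally have "norm (Y x - (\<Sum>i<n. b i *\<^sub>R p i)) \<le> e" .
  then have "dist (T (Y x)) (Y x) \<le> 2 * e"
    using near[OF S] dist_triangle3[of "T (Y x)" "Y x" "\<Sum>i<n. b i *\<^sub>R p i"]
    by (simp add: b_def dist_norm norm_minus_commute)
  then show thesis
    by (rule that[OF Y[OF x]])
qed

text \<open>The displacement \<open>dist (T x) x\<close> attains its minimum on the compact set, and
  approximate fixed points force this minimum to be 0.\<close>

theorem Schauder_fixpoint: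
  fixes S :: "'a::real_normed_vector set"
  assumes "compact S" "convex S" "S \<noteq> {}"
    and contT: "continuous_on S T" and "\<And>x. x \<in> S \<Longrightarrow> T x \<in> S"
  obtains x where "x \<in> S" "T x = x"
proof -
  have "continuous_on S (\<lambda>x. dist (T x) x)"
    by (rule continuous_on_dist[OF contT continuous_on_id])
  then obtain x where x: "x \<in> S" "\<And>y. y \<in> S \<Longrightarrow> dist (T x) x \<le> dist (T y) y"
    using continuous_attains_inf[OF assms(1,3)] by blast
  have "dist (T x) x \<le> 0 + e" if e: "e > 0" for e
  proof -
    obtain y where "y \<in> S" "dist (T y) y \<le> 2 * (e / 2)"
      using Schauder_approximate_fixpoint[OF assms(1-4) assms(5) half_gt_zero[OF e]] .
    then show ?thesis
      using x(2)[of y] by simp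
  qed
  then have "dist (T x) x \<le> 0"
    by (rule field_le_epsilon)
  then show thesis
    using that x by simp
qed

section \<open>Finite-dimensional complex spaces\<close>

lemma bounded_linear_scaleC_left: "bounded_linear (\<lambda>z. z *\<^sub>C (x :: 'a::complex_normed_vector))"
proof (rule bounded_linear_intro[where K = "norm x"])
  fix r :: real and z :: complex
  have "(r *\<^sub>R z) *\<^sub>C x = (complex_of_real r * z) *\<^sub>C x"
    by (simp only: scaleR_conv_of_real)
  also have "\<dots> = r *\<^sub>R z *\<^sub>C x"
    by (simp only: scaleC_scaleC[symmetric] scaleC_of_real)
  finally show "(r *\<^sub>R z) *\<^sub>C x = r *\<^sub>R z *\<^sub>C x" .
qed (simp_all add: scaleC_add_left norm_scaleC)

lemma finite_cdim_obtain_basis: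
  assumes "finite_cdim TYPE('a::complex_normed_vector)"
  obtains B :: "'a::complex_normed_vector set" where "finite B" "complex_vector.independent B" "complex_vector.span B = UNIV"
proof -
  obtain B0 :: "'a set" where B0: "finite B0" "complex_vector.span B0 = UNIV"
    using assms by (auto simp: finite_cdim_def)
  obtain B where B: "B \<subseteq> B0" "complex_vector.independent B" "B0 \<subseteq> complex_vector.span B"
    by (rule complex_vector.maximal_independent_subset[of B0])
  have "complex_vector.span B = UNIV"
    using complex_vector.span_minimal[OF B(3) complex_vector.subspace_span] B0 by auto
  then show thesis
    using that B B0 finite_subset by blast
qed

text \<open>By independence the norm of a combination has a positive minimum \<open>m\<close> over
  coordinates of maximum norm 1. Scaling shows that coordinates are bounded by the norm over
  \<open>m\<close>, so the ball is a closed part of the continuous image of a compact box.\<close>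

lemma compact_cball_finite_cdim:
  assumes "finite_cdim TYPE('a::complex_normed_vector)"
  shows "compact (cball (0::'a::complex_normed_vector) R)"
proof -
  obtain B :: "'a set" where B: "finite B" "complex_vector.independent B" "complex_vector.span B = UNIV"
    by (rule finite_cdim_obtain_basis[OF assms])
  define \<Phi> where "\<Phi> a = (\<Sum>b\<in>B. a b *\<^sub>C b)" for a :: "'a \<Rightarrow> complex"
  have cont: "continuous_on X \<Phi>" for X
  proof -
    have "continuous_on UNIV (\<lambda>a :: 'a \<Rightarrow> complex. a b *\<^sub>C b)" for b :: 'a
      by (rule bounded_linear.continuous_on[OF bounded_linear_scaleC_left]) simp
    then have "continuous_on UNIV \<Phi>"
      unfolding \<Phi>_def by (intro continuous_on_sum)
    then show ?thesis
      using continuous_on_subset by blast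
  qed
  have rep: "\<exists>a. (\<forall>b. b \<notin> B \<longrightarrow> a b = 0) \<and> \<Phi> a = x" for x
  proof -
    have "x \<in> complex_vector.span B"
      using B by simp
    then obtain u where u: "x = (\<Sum>v\<in>B. u v *\<^sub>C v)"
      using complex_vector.span_finite[OF B(1)] by auto
    then show ?thesis
      by (intro exI[of _ "\<lambda>b. if b \<in> B then u b else 0"]) (auto simp: \<Phi>_def intro!: sum.cong)
  qed
  define box where "box r = PiE UNIV (\<lambda>b::'a. if b \<in> B then cball (0::complex) r else {0})" for r
  have box: "compact (box r)" for r
    unfolding box_def by (rule compact_PiE_UNIV) auto
  have mem_box: "a \<in> box r \<longleftrightarrow> (\<forall>b\<in>B. cmod (a b) \<le> r) \<and> (\<forall>b. b \<notin> B \<longrightarrow> a b = 0)" for a r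
    by (auto simp: box_def PiE_iff split: if_splits)
  define Sph where "Sph = box 1 \<inter> (\<Union>b\<in>B. {a. cmod (a b) = 1})"
  have "closed {a :: 'a \<Rightarrow> complex. cmod (a b) = 1}" for b
    by (intro closed_Collect_eq continuous_intros) simp
  then have Sph: "compact Sph"
    unfolding Sph_def using B(1) by (intro compact_Int_closed box closed_UN) auto
  have pos: "norm (\<Phi> a) > 0" if "a \<in> Sph" for a
    using that B complex_vector.independentD[OF B(2,1) order_refl, of a]
    by (auto simp: Sph_def \<Phi>_def)
  obtain m where m: "m > 0" "\<And>a. a \<in> Sph \<Longrightarrow> m \<le> norm (\<Phi> a)"
  proof (cases "Sph = {}")
    \<comment> \<open>The sphere is empty exactly when \<open>B\<close> is, that is, for the zero
      space.\<close>
    case True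
    then show thesis
      using that[of 1] by auto
  next
    case False
    obtain a0 where "a0 \<in> Sph" "\<And>a. a \<in> Sph \<Longrightarrow> norm (\<Phi> a0) \<le> norm (\<Phi> a)"
      using continuous_attains_inf[OF Sph False continuous_on_norm[OF cont]] by blast
    then show thesis
      using that[of "norm (\<Phi> a0)"] pos by blast
  qed
  have coord: "cmod (a b) \<le> norm (\<Phi> a) / m" if a: "\<forall>b. b \<notin> B \<longrightarrow> a b = 0" and "b \<in> B" for a b
  proof -
    define N where "N = Max ((\<lambda>b. cmod (a b)) ` B)"
    have le: "cmod (a b) \<le> N" if "b \<in> B" for b
      using that B by (auto simp: N_def)
    have "N \<in> (\<lambda>b. cmod (a b)) ` B"
      unfolding N_def using B that by (intro Max_in) auto
    then obtain b0 where b0: "b0 \<in> B" "N = cmod (a b0)"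
      by blast
    have "m * N \<le> norm (\<Phi> a)"
    proof (cases "N = 0")
      case False
      then have N: "N > 0"
        using b0 by auto
      define a' where "a' b = complex_of_real (1 / N) * a b" for b
      have "a' \<in> Sph"
        using a le b0 N by (auto simp: Sph_def mem_box a'_def norm_mult norm_divide)
      moreover have "\<Phi> a' = complex_of_real (1 / N) *\<^sub>C \<Phi> a"
        by (simp add: \<Phi>_def a'_def complex_vector.scale_sum_right)
      ultimately have "m \<le> norm (\<Phi> a) / N"
        using m(2)[of a'] N by (simp add: norm_scaleC norm_divide)
      then show ?thesis
        using N by (simp add: field_simps)
    qed auto
    then have "m * cmod (a b) \<le> norm (\<Phi> a)"
      using mult_left_mono[OF le[OF \<open>b \<in> B\<close>], of m] m(1) by linarith
    then show ?thesis
      using m(1) by (simp add: pos_le_divide_eq mult.commute)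
  qed
  have "cball 0 R \<subseteq> \<Phi> ` box (R / m)"
  proof
    fix x :: 'a assume x: "x \<in> cball 0 R"
    obtain a where a: "\<forall>b. b \<notin> B \<longrightarrow> a b = 0" "\<Phi> a = x"
      using rep by blast
    have "cmod (a b) \<le> R / m" if "b \<in> B" for b
      using coord[OF a(1) that] divide_right_mono[of "norm x" R m] a(2) x m(1) by simp
    then have "a \<in> box (R / m)"
      using a by (auto simp: mem_box)
    then show "x \<in> \<Phi> ` box (R / m)"
      unfolding a(2)[symmetric] by (rule imageI)
  qed
  then have "cball 0 R = \<Phi> ` box (R / m) \<inter> cball 0 R"
    by blast
  moreover have "compact (\<Phi> ` box (R / m) \<inter> cball 0 R)"
    by (intro compact_Int_closed compact_continuous_image cont box) auto
  ultimately show ?thesis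
    by simp
qed

text \<open>The \<open>N + 1\<close> iterates of \<open>v\<close> outnumber the dimension
  \<open>N\<close>, and the coefficients of a linear relation among them form the
  polynomial.\<close>

lemma ex_annihilating_poly:
  fixes f :: "'a::complex_normed_vector \<Rightarrow> 'a"
  assumes "finite_cdim TYPE('a)"
  obtains p :: "complex poly" and N where "p \<noteq> 0" "degree p \<le> N" "(\<Sum>i\<le>N. coeff p i *\<^sub>C (f ^^ i) v) = 0"
proof -
  obtain B :: "'a set" where B: "finite B" "complex_vector.independent B" "complex_vector.span B = UNIV"
    by (rule finite_cdim_obtain_basis[OF assms])
  define N where "N = card B"
  let ?x = "\<lambda>i. (f ^^ i) v"
  show thesis
  proof (cases "inj_on ?x {..N}")
    \<comment> \<open>A repetition would make the set of iterates too small for the dimension count,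
      but it is itself a relation.\<close>
    case False
    then obtain i j where ij: "i \<le> N" "j \<le> N" "i \<noteq> j" "?x i = ?x j"
      by (auto simp: inj_on_def)
    let ?p = "monom 1 i - monom 1 j :: complex poly"
    have "coeff ?p i \<noteq> coeff 0 i"
      using ij by simp
    then have "?p \<noteq> 0"
      by metis
    moreover have "degree ?p \<le> N"
      using ij by (intro degree_diff_le) (auto simp: degree_monom_eq)
    moreover have "(\<Sum>k\<le>N. coeff ?p k *\<^sub>C ?x k) = (\<Sum>k\<le>N. if i = k then ?x k else 0) - (\<Sum>k\<le>N. if j = k then ?x k else 0)"
      unfolding sum_subtractf[symmetric]
      by (intro sum.cong) (auto simp: complex_vector.scale_left_diff_distrib)
    then have "(\<Sum>k\<le>N. coeff ?p k *\<^sub>C ?x k) = 0"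
      using ij by simp
    ultimately show thesis
      using that by blast
  next
    case True
    then have "card (?x ` {..N}) = N + 1"
      by (simp add: card_image)
    then have "complex_vector.dependent (?x ` {..N})"
      using complex_vector.independent_span_bound[OF B(1), of "?x ` {..N}"] B(3)
      by (auto simp: N_def)
    then obtain u b where u: "b \<in> ?x ` {..N}" "u b \<noteq> 0" "(\<Sum>y\<in>?x ` {..N}. u y *\<^sub>C y) = 0"
      using complex_vector.dependent_finite[of "?x ` {..N}"] by auto
    define p where "p = (\<Sum>i\<le>N. monom (u (?x i)) i)"
    have cp: "coeff p k = (if k \<le> N then u (?x k) else 0)" for k
      by (auto simp: p_def coeff_sum)
    obtain i where "i \<le> N" "b = ?x i"
      using u by auto
    then have "p \<noteq> 0"
      using u cp[of i] by auto
    moreover have "degree p \<le> N"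
      by (rule degree_le) (auto simp: cp)
    moreover have "(\<Sum>k\<le>N. coeff p k *\<^sub>C ?x k) = 0"
      using u(3) by (simp add: cp sum.reindex[OF True])
    ultimately show thesis
      using that by blast
  qed
qed

text \<open>If \<open>p\<close> has least degree with \<open>p(f) v = 0\<close> and \<open>p = (X - \<mu>) q\<close>, then \<open>q(f) v\<close> is an
  eigenvector for \<open>\<mu>\<close>.\<close>

lemma ex_eigenvector_invariant:
  fixes f :: "'a::complex_normed_vector \<Rightarrow> 'a"
  assumes fin: "finite_cdim TYPE('a)" and lin: "Vector_Spaces.linear scaleC scaleC f"
    and V: "complex_vector.subspace V" "\<And>x. x \<in> V \<Longrightarrow> f x \<in> V" and v: "v \<in> V" "v \<noteq> 0"
  obtains \<mu> w where "w \<in> V" "w \<noteq> 0" "f w = \<mu> *\<^sub>C w"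
proof -
  interpret f: Vector_Spaces.linear "scaleC :: complex \<Rightarrow> 'a \<Rightarrow> 'a" "scaleC :: complex \<Rightarrow> 'a \<Rightarrow> 'a" f
    by (rule lin)
  obtain p0 :: "complex poly" and N
    where p0: "p0 \<noteq> 0" "degree p0 \<le> N" "(\<Sum>i\<le>N. coeff p0 i *\<^sub>C (f ^^ i) v) = 0"
    by (rule ex_annihilating_poly[OF fin])
  define ev where "ev p = (\<Sum>i\<le>N. coeff p i *\<^sub>C (f ^^ i) v)" for p
  obtain p where p: "p \<noteq> 0 \<and> degree p \<le> N \<and> ev p = 0"
    and min: "\<And>q. q \<noteq> 0 \<and> degree q \<le> N \<and> ev q = 0 \<Longrightarrow> degree p \<le> degree q"
    using ex_has_least_nat[of "\<lambda>p. p \<noteq> 0 \<and> degree p \<le> N \<and> ev p = 0" p0 degree] p0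
    unfolding ev_def by blast
  have "\<not> constant (poly p)"
  proof
    assume "constant (poly p)"
    then have "degree p = 0"
      by (simp add: constant_degree)
    then obtain a where a: "p = [:a:]"
      by (metis degree_eq_zeroE)
    have "ev p = (\<Sum>i\<le>N. if 0 = i then a *\<^sub>C v else 0)"
      unfolding ev_def a by (intro sum.cong) (auto simp: coeff_pCons split: nat.splits)
    then show False
      using p a v by simp
  qed
  then obtain \<mu> where "poly p \<mu> = 0"
    using fundamental_theorem_of_algebra by blast
  then obtain q where q: "p = [:- \<mu>, 1:] * q"
    by (auto simp: poly_eq_0_iff_dvd)
  have q0: "q \<noteq> 0"
    using p q by auto
  then have dq: "degree p = Suc (degree q)"
    unfolding q by (subst degree_mult_eq) auto
  have "ev q \<noteq> 0"
    using min[of q] p dq q0 by auto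
  have pow: "(f ^^ i) v \<in> V" for i
    by (induction i) (auto simp: v V)
  have "ev q \<in> V"
    unfolding ev_def by (intro complex_vector.subspace_sum V(1) complex_vector.subspace_scale pow)
  \<comment> \<open>Applying \<open>f\<close> shifts the coefficients of \<open>q\<close> by one;
    the vanishing top coefficient keeps the shifted sum within \<open>{..N}\<close>. The rest is the
    identity X q = p + \<mu> q.\<close>
  have "coeff q N = 0"
    using dq p by (intro coeff_eq_0) auto
  have "f (ev q) = (\<Sum>i\<le>N. coeff q i *\<^sub>C (f ^^ Suc i) v)"
    by (simp add: ev_def f.sum f.scale)
  also have "\<dots> = (\<Sum>i\<le>Suc N. coeff (pCons 0 q) i *\<^sub>C (f ^^ i) v)"
    by (subst sum.atMost_Suc_shift) simp
  also have "\<dots> = (\<Sum>i\<le>N. coeff (pCons 0 q) i *\<^sub>C (f ^^ i) v)"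
    using \<open>coeff q N = 0\<close> by simp
  also have "\<dots> = (\<Sum>i\<le>N. coeff p i *\<^sub>C (f ^^ i) v + (\<mu> * coeff q i) *\<^sub>C (f ^^ i) v)"
    by (intro sum.cong refl) (simp add: q flip: scaleC_add_left)
  also have "\<dots> = ev p + \<mu> *\<^sub>C ev q"
    by (simp add: sum.distrib ev_def complex_vector.scale_sum_right scaleC_scaleC)
  finally have "f (ev q) = \<mu> *\<^sub>C ev q"
    using p by simp
  then show thesis
    using that \<open>ev q \<in> V\<close> \<open>ev q \<noteq> 0\<close> by blast
qed

text \<open>The dimension count gives the inverse as a map only. It is bounded because
  \<open>norm (T x)\<close> has a positive minimum \<open>m\<close> on the compact unit sphere, so
  that \<open>1 / m\<close> bounds the inverse.\<close>

lemma finite_cdim_injective_imp_invertible: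
  fixes T :: "'a::complex_normed_vector \<Rightarrow>\<^sub>L 'a"
  assumes fin: "finite_cdim TYPE('a)" and T: "T \<in> complex_operators"
    and inj: "\<And>x. T x = 0 \<Longrightarrow> x = 0"
  obtains S where "S o\<^sub>L T = id_blinfun" "T o\<^sub>L S = id_blinfun"
proof -
  obtain B :: "'a set" where B: "finite B" "complex_vector.independent B" "complex_vector.span B = UNIV"
    by (rule finite_cdim_obtain_basis[OF fin])
  interpret fd: finite_dimensional_vector_space "scaleC :: complex \<Rightarrow> 'a \<Rightarrow> 'a" B
    by unfold_locales (use B in auto)
  have "inj (blinfun_apply T)"
    using inj by (intro injI) (metis blinfun.diff_right eq_iff_diff_eq_0)
  moreover from this have "surj (blinfun_apply T)"
    using T fd.linear_inj_imp_surj by (auto simp: complex_operators_def)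
  ultimately have bij: "bij (blinfun_apply T)"
    by (simp add: bij_def)
  obtain m where m: "m > 0" "\<And>x. m * norm x \<le> norm (T x)"
  proof (cases "sphere (0::'a) 1 = {}")
    case True
    have "x = 0" for x :: 'a
    proof (rule ccontr)
      assume "x \<noteq> 0"
      then have "x /\<^sub>R norm x \<in> sphere 0 1"
        by simp
      with True show False
        by blast
    qed
    then have "1 * norm x \<le> norm (T x)" for x
      by (metis mult.right_neutral norm_ge_zero norm_zero mult_1)
    then show thesis
      using that[of 1] by simp
  next
    case False
    have "closed (sphere (0::'a) 1)"
      unfolding sphere_def by (intro closed_Collect_eq continuous_intros)
    then have "compact (cball (0::'a) 1 \<inter> sphere 0 1)"
      by (intro compact_Int_closed compact_cball_finite_cdim fin)
    then have "compact (sphere (0::'a) 1)"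
      by (simp add: Int_absorb1 sphere_cball)
    moreover have "continuous_on (sphere 0 1) (\<lambda>x. norm (T x))"
      by (intro continuous_on_norm linear_continuous_on blinfun.bounded_linear_right)
    ultimately obtain x0 :: 'a where x0: "norm x0 = 1" "\<And>x. norm x = 1 \<Longrightarrow> norm (T x0) \<le> norm (T x)"
      using continuous_attains_inf[OF _ False, of "\<lambda>x. norm (T x)"] by auto
    have "norm (T x0) * norm x \<le> norm (T x)" for x
    proof (cases "x = 0")
      case False
      have "norm (T x0) \<le> norm (T (x /\<^sub>R norm x))"
        using False by (intro x0) simp
      then show ?thesis
        using False by (simp add: blinfun.scaleR_right field_simps)
    qed simp
    moreover have "norm (T x0) > 0"
      using inj[of x0] x0 by auto
    ultimately show thesis
      using that by blast
  qed
  define S where "S = Blinfun (inv (blinfun_apply T))"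
  have TS: "T (inv (blinfun_apply T) y) = y" and ST: "inv (blinfun_apply T) (T y) = y" for y
    using bij by (simp_all add: bij_is_inj bij_is_surj surj_f_inv_f)
  have "bounded_linear (inv (blinfun_apply T))"
  proof (rule bounded_linear_intro[where K = "1 / m"])
    show "inv (blinfun_apply T) (x + y) = inv (blinfun_apply T) x + inv (blinfun_apply T) y" for x y
      by (metis ST TS blinfun.add_right)
    show "inv (blinfun_apply T) (r *\<^sub>R x) = r *\<^sub>R inv (blinfun_apply T) x" for r x
      by (metis ST TS blinfun.scaleR_right)
    show "norm (inv (blinfun_apply T) x) \<le> norm x * (1 / m)" for x
      using m(2)[of "inv (blinfun_apply T) x"] m(1) by (simp add: TS field_simps)
  qed
  then have "blinfun_apply S = inv (blinfun_apply T)"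
    by (simp add: S_def bounded_linear_Blinfun_apply)
  then show thesis
    by (intro that[of S] blinfun_eqI) (simp_all add: TS ST)
qed

section \<open>The operator exponential\<close>

interpretation blinfun_compose: bounded_bilinear "(o\<^sub>L)"
  by (rule bounded_bilinear_blinfun_compose)

lemma blinfun_compose_assoc: "(S o\<^sub>L T) o\<^sub>L U = S o\<^sub>L (T o\<^sub>L U)"
  by (rule blinfun_eqI) simp

lemma op_exp_power:
  fixes A :: "'a::real_normed_vector \<Rightarrow>\<^sub>L 'a"
  shows "((\<lambda>S. (t *\<^sub>R A) o\<^sub>L S) ^^ n) U = t ^ n *\<^sub>R ((\<lambda>S. A o\<^sub>L S) ^^ n) U"
  by (induction n) (simp_all add: blinfun_compose.scaleR_left blinfun_compose.scaleR_right)

text \<open>Split off from \<open>t ^ n\<close>, these exhibit \<open>op_exp (t *\<^sub>R A)\<close>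
  as a power series in \<open>t\<close>.\<close>

definition op_exp_coeff :: "('a::banach \<Rightarrow>\<^sub>L 'a) \<Rightarrow> nat \<Rightarrow> ('a \<Rightarrow>\<^sub>L 'a)" where
  "op_exp_coeff A n = ((\<lambda>S. A o\<^sub>L S) ^^ n) id_blinfun /\<^sub>R fact n"

lemma op_exp_coeff_0: "op_exp_coeff A 0 = id_blinfun"
  by (simp add: op_exp_coeff_def)

text \<open>The differential equation E' = A E, read off coefficientwise.\<close>

lemma op_exp_coeff_Suc: "real (Suc n) *\<^sub>R op_exp_coeff A (Suc n) = A o\<^sub>L op_exp_coeff A n"
  by (simp add: op_exp_coeff_def blinfun_compose.scaleR_right divide_simps)

lemma op_exp_coeff_apply: "op_exp_coeff A n x = (blinfun_apply A ^^ n) x /\<^sub>R fact n"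
proof -
  have "blinfun_apply (((\<lambda>S. A o\<^sub>L S) ^^ n) id_blinfun) x = (blinfun_apply A ^^ n) x"
    by (induction n) auto
  then show ?thesis
    by (simp add: op_exp_coeff_def blinfun.scaleR_left)
qed

lemma norm_op_exp_coeff_le: "norm (op_exp_coeff A n) \<le> norm A ^ n / fact n"
proof -
  have "norm (((\<lambda>S. A o\<^sub>L S) ^^ n) id_blinfun) \<le> norm A ^ n"
  proof (induction n)
    case 0
    then show ?case
      by (simp add: norm_blinfun_id_le)
  next
    case (Suc n)
    then show ?case
      using order_trans[OF norm_blinfun_compose mult_left_mono[OF Suc norm_ge_zero]] by simp
  qed
  then show ?thesis
    by (simp add: op_exp_coeff_def divide_simps)
qed

lemma summable_op_exp: "summable (\<lambda>n. t ^ n *\<^sub>R op_exp_coeff A n)"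
proof (rule summable_comparison_test'[where N = 0])
  show "summable (\<lambda>n. (\<bar>t\<bar> * norm A) ^ n / fact n)"
    using summable_exp[of "\<bar>t\<bar> * norm A"] by (simp add: divide_inverse mult.commute)
  show "norm (t ^ n *\<^sub>R op_exp_coeff A n) \<le> (\<bar>t\<bar> * norm A) ^ n / fact n" for n
    using mult_left_mono[OF norm_op_exp_coeff_le[of A n], of "\<bar>t\<bar> ^ n"]
    by (simp add: power_abs power_mult_distrib)
qed

lemma op_exp_eq_suminf: "op_exp (t *\<^sub>R A) = (\<Sum>n. t ^ n *\<^sub>R op_exp_coeff A n)"
  by (simp add: op_exp_def op_exp_power op_exp_coeff_def scaleR_left_commute mult.commute)

lemma op_exp_sums: "(\<lambda>n. t ^ n *\<^sub>R op_exp_coeff A n) sums op_exp (t *\<^sub>R A)"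
  using summable_sums[OF summable_op_exp] by (simp add: op_exp_eq_suminf)

lemma op_exp_apply_sums: "(\<lambda>n. (t ^ n / fact n) *\<^sub>R (blinfun_apply A ^^ n) x) sums op_exp (t *\<^sub>R A) x"
  using bounded_linear.sums[OF blinfun.bounded_linear_left op_exp_sums[of t A], of x]
  by (simp add: blinfun.scaleR_left op_exp_coeff_apply divide_inverse)

lemma op_exp_scaleR_0: "op_exp (0 *\<^sub>R A) = id_blinfun"
proof -
  have "(\<lambda>n. 0 ^ n *\<^sub>R op_exp_coeff A n) sums (0 ^ 0 *\<^sub>R op_exp_coeff A 0)"
    using sums_finite[of "{0::nat}" "\<lambda>n. 0 ^ n *\<^sub>R op_exp_coeff A n"] by simp
  then show ?thesis
    using sums_unique2[OF op_exp_sums[of 0 A]] by (simp add: op_exp_coeff_0)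
qed

text \<open>The series may be differentiated termwise because the derived series converges uniformly
  on bounded intervals; by the coefficient recursion its sum is \<open>A\<close> composed with the
  exponential.\<close>

lemma op_exp_has_vector_derivative:
  "((\<lambda>t. op_exp (t *\<^sub>R A)) has_vector_derivative (A o\<^sub>L op_exp (t *\<^sub>R A))) (at t)"
proof -
  \<comment> \<open>The interval must be bounded for the M-test, and it contains 0 as the point
    where convergence of the undifferentiated series is supplied.\<close>
  define r where "r = \<bar>t\<bar> + 1"
  define S where "S = {-r<..<r}"
  have S: "open S" "convex S" "t \<in> S" "0 \<in> S"
    by (auto simp: S_def r_def)
  define f' where "f' n t = (real n * t ^ (n - 1)) *\<^sub>R op_exp_coeff A n" for n and t :: real
  have f'_Suc: "f' (Suc n) t = A o\<^sub>L (t ^ n *\<^sub>R op_exp_coeff A n)" for n t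
  proof -
    have "f' (Suc n) t = t ^ n *\<^sub>R real (Suc n) *\<^sub>R op_exp_coeff A (Suc n)"
      by (simp add: f'_def mult.commute)
    then show ?thesis
      by (simp only: op_exp_coeff_Suc blinfun_compose.scaleR_right)
  qed
  have f'_sums: "(\<lambda>n. f' n t) sums (A o\<^sub>L op_exp (t *\<^sub>R A))" for t
  proof -
    have "(\<lambda>n. f' (Suc n) t) sums (A o\<^sub>L op_exp (t *\<^sub>R A))"
      unfolding f'_Suc by (rule bounded_linear.sums[OF blinfun_compose.bounded_linear_right op_exp_sums])
    then show ?thesis
      by (subst (asm) sums_Suc_iff) (simp add: f'_def)
  qed
  \<comment> \<open>The derived term of index 0 vanishes, which accounts for the shift by
    one.\<close>
  define M where "M n = (case n of 0 \<Rightarrow> 0 | Suc m \<Rightarrow> norm A * ((r * norm A) ^ m / fact m))" for n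
  have "summable (\<lambda>n. M (Suc n))"
    using summable_mult[OF summable_exp[of "r * norm A"], of "norm A"] by (simp add: M_def divide_inverse mult.commute mult.left_commute)
  then have "summable M"
    by (simp only: summable_Suc_iff)
  have "uniform_limit S (\<lambda>n x. \<Sum>i<n. f' i x) (\<lambda>x. suminf (\<lambda>i. f' i x)) sequentially"
  proof (rule Weierstrass_m_test[OF _ \<open>summable M\<close>])
    fix n x assume x: "x \<in> S"
    show "norm (f' n x) \<le> M n"
    proof (cases n)
      case (Suc m)
      have "norm (x ^ m *\<^sub>R op_exp_coeff A m) \<le> r ^ m * (norm A ^ m / fact m)"
        using x unfolding norm_scaleR power_abs
        by (intro mult_mono power_mono norm_op_exp_coeff_le) (auto simp: S_def r_def power_abs)
      then have "norm (A o\<^sub>L (x ^ m *\<^sub>R op_exp_coeff A m)) \<le> norm A * (r ^ m * (norm A ^ m / fact m))"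
        by (rule order_trans[OF norm_blinfun_compose mult_left_mono[OF _ norm_ge_zero]])
      then show ?thesis
        by (simp add: Suc f'_Suc M_def power_mult_distrib)
    qed (simp add: f'_def M_def)
  qed
  then have unif: "uniform_limit S (\<lambda>n x. \<Sum>i<n. f' i x) (\<lambda>x. A o\<^sub>L op_exp (x *\<^sub>R A)) sequentially"
    using f'_sums by (simp add: sums_iff)
  have "\<exists>g. \<forall>x\<in>S. (\<lambda>n. x ^ n *\<^sub>R op_exp_coeff A n) sums g x \<and>
      (g has_derivative (\<lambda>h. h *\<^sub>R (A o\<^sub>L op_exp (x *\<^sub>R A)))) (at x within S)"
  proof (rule has_derivative_series[OF S(2) _ _ S(4) op_exp_sums])
    fix n x
    have "((\<lambda>x. x ^ n *\<^sub>R op_exp_coeff A n) has_vector_derivative f' n x) (at x within S)"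
      unfolding f'_def by (auto intro!: derivative_eq_intros)
    then show "((\<lambda>x. x ^ n *\<^sub>R op_exp_coeff A n) has_derivative (\<lambda>h. h *\<^sub>R f' n x)) (at x within S)"
      by (simp add: has_vector_derivative_def)
  next
    fix e :: real assume "e > 0"
    have "norm ((\<Sum>i<n. h *\<^sub>R f' i x) - h *\<^sub>R (A o\<^sub>L op_exp (x *\<^sub>R A))) \<le> e * norm h"
      if "dist (\<Sum>i<n. f' i x) (A o\<^sub>L op_exp (x *\<^sub>R A)) < e" for n x h
    proof -
      have "(\<Sum>i<n. h *\<^sub>R f' i x) - h *\<^sub>R (A o\<^sub>L op_exp (x *\<^sub>R A)) = h *\<^sub>R ((\<Sum>i<n. f' i x) - (A o\<^sub>L op_exp (x *\<^sub>R A)))"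
        by (simp add: scaleR_diff_right scaleR_sum_right)
      then show ?thesis
        using mult_right_mono[of "norm ((\<Sum>i<n. f' i x) - (A o\<^sub>L op_exp (x *\<^sub>R A)))" e "\<bar>h\<bar>"] that
        by (simp add: dist_norm mult.commute)
    qed
    then show "\<forall>\<^sub>F n in sequentially. \<forall>x\<in>S. \<forall>h.
        norm ((\<Sum>i<n. h *\<^sub>R f' i x) - h *\<^sub>R (A o\<^sub>L op_exp (x *\<^sub>R A))) \<le> e * norm h"
      using uniform_limitD[OF unif \<open>e > 0\<close>] by (auto elim!: eventually_mono)
  qed
  then obtain g where g: "\<And>x. x \<in> S \<Longrightarrow> (\<lambda>n. x ^ n *\<^sub>R op_exp_coeff A n) sums g x"
    "\<And>x. x \<in> S \<Longrightarrow> (g has_vector_derivative (A o\<^sub>L op_exp (x *\<^sub>R A))) (at x within S)"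
    by (auto simp: has_vector_derivative_def)
  have "op_exp (x *\<^sub>R A) = g x" if "x \<in> S" for x
    by (rule sums_unique2[OF op_exp_sums g(1)[OF that]])
  then have "((\<lambda>t. op_exp (t *\<^sub>R A)) has_vector_derivative (A o\<^sub>L op_exp (t *\<^sub>R A))) (at t within S)"
    by (rule has_vector_derivative_transform[OF S(3) _ g(2)[OF S(3)]])
  then show ?thesis
    by (simp only: at_within_open[OF S(3,1)])
qed

section \<open>Commutation and the group law of the exponential\<close>

lemma op_exp_commute: "op_exp (t *\<^sub>R A) o\<^sub>L A = A o\<^sub>L op_exp (t *\<^sub>R A)"
proof (rule blinfun_eqI)
  fix x
  have "(\<lambda>n. (t ^ n / fact n) *\<^sub>R (blinfun_apply A ^^ n) (A x)) sums op_exp (t *\<^sub>R A) (A x)"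
    by (rule op_exp_apply_sums)
  moreover have "(\<lambda>n. (t ^ n / fact n) *\<^sub>R (blinfun_apply A ^^ n) (A x)) sums A (op_exp (t *\<^sub>R A) x)"
    using bounded_linear.sums[OF blinfun.bounded_linear_right op_exp_apply_sums[of t A x], of A]
    by (simp add: blinfun.scaleR_right funpow_swap1)
  ultimately have "op_exp (t *\<^sub>R A) (A x) = A (op_exp (t *\<^sub>R A) x)"
    by (rule sums_unique2)
  then show "(op_exp (t *\<^sub>R A) o\<^sub>L A) x = (A o\<^sub>L op_exp (t *\<^sub>R A)) x"
    by simp
qed

text \<open>With \<open>A\<close> on the right, this derivative cancels against that of a second
  exponential factor, where \<open>A\<close> stands on the left.\<close>

lemma op_exp_minus_derivative:
  "((\<lambda>t. op_exp ((- t) *\<^sub>R A)) has_vector_derivative - (op_exp ((- t) *\<^sub>R A) o\<^sub>L A)) (at t)"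
proof -
  have "((\<lambda>t. op_exp (t *\<^sub>R A)) \<circ> uminus has_vector_derivative (- 1) *\<^sub>R (A o\<^sub>L op_exp ((- t) *\<^sub>R A))) (at t)"
    by (rule vector_diff_chain_at[OF _ op_exp_has_vector_derivative]) (auto intro!: derivative_eq_intros)
  then show ?thesis
    unfolding op_exp_commute by (simp add: o_def)
qed

text \<open>By the product rule the left-hand side has derivative 0 in \<open>t\<close>, and at
  \<open>t = 0\<close> it is the right-hand side. The choice \<open>u = 0\<close> gives inverses,
  and these give the group law.\<close>

lemma op_exp_minus_add: "op_exp ((- t) *\<^sub>R A) o\<^sub>L op_exp ((t + u) *\<^sub>R A) = op_exp (u *\<^sub>R A)"
proof -
  let ?F = "\<lambda>t. op_exp ((- t) *\<^sub>R A) o\<^sub>L op_exp ((t + u) *\<^sub>R A)"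
  have "(?F has_vector_derivative 0) (at t)" for t
  proof -
    have "((\<lambda>t. op_exp (t *\<^sub>R A)) \<circ> (\<lambda>t. t + u) has_vector_derivative 1 *\<^sub>R (A o\<^sub>L op_exp ((t + u) *\<^sub>R A))) (at t)"
      by (rule vector_diff_chain_at[OF _ op_exp_has_vector_derivative]) (auto intro!: derivative_eq_intros)
    then have 1: "((\<lambda>t. op_exp ((t + u) *\<^sub>R A)) has_vector_derivative (A o\<^sub>L op_exp ((t + u) *\<^sub>R A))) (at t)"
      by (simp add: o_def)
    have "(?F has_vector_derivative (op_exp ((- t) *\<^sub>R A) o\<^sub>L (A o\<^sub>L op_exp ((t + u) *\<^sub>R A))) +
        ((- (op_exp ((- t) *\<^sub>R A) o\<^sub>L A)) o\<^sub>L op_exp ((t + u) *\<^sub>R A))) (at t)"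
      by (rule bounded_bilinear.has_vector_derivative[OF bounded_bilinear_blinfun_compose op_exp_minus_derivative 1])
    then show ?thesis
      by (simp add: blinfun_compose.minus_left blinfun_compose_assoc)
  qed
  then obtain k where "\<And>t. ?F t = k"
    using has_vector_derivative_zero_constant[of UNIV ?F] by auto
  then have "?F t = ?F 0"
    by metis
  also have "\<dots> = op_exp (u *\<^sub>R A)"
    using op_exp_scaleR_0[of A] by (auto intro: blinfun_eqI)
  finally show ?thesis .
qed

lemma op_exp_minus_cancel:
  "op_exp ((- t) *\<^sub>R A) o\<^sub>L op_exp (t *\<^sub>R A) = id_blinfun"
  "op_exp (t *\<^sub>R A) o\<^sub>L op_exp ((- t) *\<^sub>R A) = id_blinfun"
  using op_exp_minus_add[of t A 0] op_exp_minus_add[of "- t" A 0] op_exp_scaleR_0[of A] by simp_all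

lemma op_exp_add: "op_exp ((t + u) *\<^sub>R A) = op_exp (t *\<^sub>R A) o\<^sub>L op_exp (u *\<^sub>R A)"
proof -
  have "op_exp (t *\<^sub>R A) o\<^sub>L op_exp (u *\<^sub>R A) = (op_exp (t *\<^sub>R A) o\<^sub>L op_exp ((- t) *\<^sub>R A)) o\<^sub>L op_exp ((t + u) *\<^sub>R A)"
    by (simp only: op_exp_minus_add blinfun_compose_assoc)
  then show ?thesis
    by (simp only: op_exp_minus_cancel) (auto intro: blinfun_eqI)
qed

lemma continuous_on_op_exp: "continuous_on X (\<lambda>t. op_exp (t *\<^sub>R A))"
  by (intro continuous_at_imp_continuous_on ballI has_vector_derivative_continuous[OF op_exp_has_vector_derivative])

section \<open>Complex linearity and eigenvectors of the exponential\<close>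

lemma complex_operators_scaleC: "T \<in> complex_operators \<Longrightarrow> T (z *\<^sub>C x) = z *\<^sub>C T x"
  by (simp add: complex_operators_def Vector_Spaces.linear_iff)

lemma complex_operatorsI:
  fixes T :: "'a::complex_normed_vector \<Rightarrow>\<^sub>L 'a"
  shows "(\<And>z x. T (z *\<^sub>C x) = z *\<^sub>C T x) \<Longrightarrow> T \<in> complex_operators"
  by (simp add: complex_operators_def Vector_Spaces.linear_iff blinfun.add_right complex_vector.vector_space_axioms)

lemma op_exp_complex_operators:
  assumes "A \<in> complex_operators"
  shows "op_exp (t *\<^sub>R A) \<in> complex_operators"
proof (rule complex_operatorsI)
  fix z x
  have pow: "(blinfun_apply A ^^ n) (z *\<^sub>C x) = z *\<^sub>C (blinfun_apply A ^^ n) x" for n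
    by (induction n) (simp_all add: complex_operators_scaleC[OF assms])
  have "(\<lambda>n. (t ^ n / fact n) *\<^sub>R (blinfun_apply A ^^ n) (z *\<^sub>C x)) sums op_exp (t *\<^sub>R A) (z *\<^sub>C x)"
    by (rule op_exp_apply_sums)
  moreover have "(\<lambda>n. (t ^ n / fact n) *\<^sub>R (blinfun_apply A ^^ n) (z *\<^sub>C x)) sums (z *\<^sub>C op_exp (t *\<^sub>R A) x)"
    using bounded_linear.sums[OF bounded_linear_scaleC op_exp_apply_sums[of t A x], of z]
    by (simp add: pow linear_scale[OF bounded_linear.linear[OF bounded_linear_scaleC]])
  ultimately show "op_exp (t *\<^sub>R A) (z *\<^sub>C x) = z *\<^sub>C op_exp (t *\<^sub>R A) x"
    by (rule sums_unique2)
qed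

lemma op_exp_eigenvector:
  assumes "A \<in> complex_operators" "A w = \<mu> *\<^sub>C w"
  shows "op_exp (t *\<^sub>R A) w = exp (complex_of_real t * \<mu>) *\<^sub>C w"
proof -
  have pow: "(blinfun_apply A ^^ n) w = \<mu> ^ n *\<^sub>C w" for n
    by (induction n) (simp_all add: complex_operators_scaleC[OF assms(1)] assms(2) scaleC_scaleC mult.commute)
  have "(\<lambda>n. ((complex_of_real t * \<mu>) ^ n /\<^sub>R fact n) *\<^sub>C w) sums (exp (complex_of_real t * \<mu>) *\<^sub>C w)"
    by (rule bounded_linear.sums[OF bounded_linear_scaleC_left exp_converges])
  moreover have "((complex_of_real t * \<mu>) ^ n /\<^sub>R fact n) *\<^sub>C w = (t ^ n / fact n) *\<^sub>R (blinfun_apply A ^^ n) w" for n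
  proof -
    have "(complex_of_real t * \<mu>) ^ n /\<^sub>R fact n = complex_of_real (t ^ n / fact n) * \<mu> ^ n"
      by (simp add: scaleR_conv_of_real power_mult_distrib divide_inverse)
    then show ?thesis
      unfolding pow by (simp only: scaleC_scaleC[symmetric] scaleC_of_real)
  qed
  ultimately show ?thesis
    using sums_unique2[OF op_exp_apply_sums[of t A w]] by simp
qed

section \<open>Spectrum and invertibility\<close>

text \<open>Two-sided inverses are unique, so the definite description in \<open>op_inverse\<close>
  denotes the given one.\<close>

lemma op_inverse_right:
  assumes "S o\<^sub>L T = id_blinfun" "T o\<^sub>L S = id_blinfun"
  shows "T o\<^sub>L op_inverse T = id_blinfun"
proof -
  have "op_inverse T = S"
    unfolding op_inverse_def
  proof (rule the_equality)
    fix S' assume "S' o\<^sub>L T = id_blinfun \<and> T o\<^sub>L S' = id_blinfun"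
    then have "S' o\<^sub>L (T o\<^sub>L S) = S"
      by (metis blinfun_compose_assoc assms(1) blinfun_apply_id_blinfun blinfun_apply_blinfun_compose blinfun_eqI)
    then show "S' = S"
      by (metis assms(2) blinfun_apply_id_blinfun blinfun_apply_blinfun_compose blinfun_eqI)
  qed (simp add: assms)
  then show ?thesis
    by (simp add: assms)
qed

lemma blinfun_scaleC_apply: "blinfun_apply (z *\<^sub>C T) x = z *\<^sub>C blinfun_apply T x"
  by (simp add: scaleC_blinfun.rep_eq)

lemma eigenvalue_in_op_spectrum:
  fixes A :: "'a::complex_normed_vector \<Rightarrow>\<^sub>L 'a"
  assumes "A w = \<mu> *\<^sub>C w" "w \<noteq> 0"
  shows "\<mu> \<in> op_spectrum A"
proof -
  have "S o\<^sub>L (\<mu> *\<^sub>C id_blinfun - A) \<noteq> id_blinfun" for S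
  proof
    assume "S o\<^sub>L (\<mu> *\<^sub>C id_blinfun - A) = id_blinfun"
    then have "S ((\<mu> *\<^sub>C id_blinfun - A) w) = w"
      by (metis blinfun_apply_id_blinfun blinfun_apply_blinfun_compose)
    moreover have "(\<mu> *\<^sub>C id_blinfun - A) w = 0"
      by (simp add: blinfun.diff_left blinfun_scaleC_apply assms)
    ultimately show False
      using assms by (simp add: blinfun.zero_right)
  qed
  then show ?thesis
    by (auto simp: op_spectrum_def)
qed

lemma op_inverse_exp_right:
  fixes A :: "'a::complex_banach \<Rightarrow>\<^sub>L 'a"
  assumes fin: "finite_cdim TYPE('a)" and A: "A \<in> complex_operators"
    and spec: "\<forall>\<mu> \<in> op_spectrum A. c \<noteq> exp (complex_of_real \<omega> * \<mu>)"
  defines "T \<equiv> c *\<^sub>C id_blinfun - op_exp (\<omega> *\<^sub>R A)"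
  shows "T o\<^sub>L op_inverse T = id_blinfun"
proof -
  have T: "T x = c *\<^sub>C x - op_exp (\<omega> *\<^sub>R A) x" for x
    by (simp add: T_def blinfun.diff_left blinfun_scaleC_apply)
  have lin: "T (z *\<^sub>C x) = z *\<^sub>C T x" for z x
    by (simp add: T complex_operators_scaleC[OF op_exp_complex_operators[OF A]]
        complex_vector.scale_right_diff_distrib scaleC_scaleC mult.commute)
  \<comment> \<open>Commutation with \<open>A\<close> is what makes the kernel of \<open>T\<close>
    invariant.\<close>
  have AT: "T (A x) = A (T x)" for x
    using arg_cong[OF op_exp_commute[of \<omega> A], of "\<lambda>S. S x"]
    by (simp add: T blinfun.diff_right complex_operators_scaleC[OF A])
  have "x = 0" if "T x = 0" for x
  proof (rule ccontr)
    assume "x \<noteq> 0"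
    define N where "N = {x. T x = 0}"
    have sub: "complex_vector.subspace N"
      by (auto simp: N_def complex_vector.subspace_def blinfun.add_right blinfun.zero_right lin)
    have linA: "Vector_Spaces.linear scaleC scaleC (blinfun_apply A)"
      using A by (simp add: complex_operators_def)
    have inv: "A y \<in> N" if "y \<in> N" for y
      using that by (simp add: N_def AT blinfun.zero_right)
    have "x \<in> N"
      using \<open>T x = 0\<close> by (simp add: N_def)
    obtain \<mu> w where "w \<in> N" and w: "w \<noteq> 0" "A w = \<mu> *\<^sub>C w"
      by (rule ex_eigenvector_invariant[OF fin linA sub inv \<open>x \<in> N\<close> \<open>x \<noteq> 0\<close>])
    then have "T w = 0"
      by (simp add: N_def)
    have "(c - exp (complex_of_real \<omega> * \<mu>)) *\<^sub>C w = 0"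
      using \<open>T w = 0\<close> by (simp add: T op_exp_eigenvector[OF A w(2)] complex_vector.scale_left_diff_distrib)
    then have "c = exp (complex_of_real \<omega> * \<mu>)"
      using w(1) by simp
    then show False
      using spec eigenvalue_in_op_spectrum[OF w(2,1)] by blast
  qed
  moreover have "T \<in> complex_operators"
    by (rule complex_operatorsI) (rule lin)
  ultimately obtain S where "S o\<^sub>L T = id_blinfun" "T o\<^sub>L S = id_blinfun"
    using finite_cdim_injective_imp_invertible[OF fin] by metis
  then show ?thesis
    by (rule op_inverse_right)
qed

section \<open>The kernel\<close>

text \<open>\<open>GREATEST\<close> is meaningful only if a greatest value exists; compactness and
  continuity provide one.\<close>

lemma
  fixes f :: "'b::topological_space \<Rightarrow> real"
  assumes "compact S" "S \<noteq> {}" "continuous_on S f"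
  shows max_on_in_image: "max_on S f \<in> f ` S" and le_max_on: "x \<in> S \<Longrightarrow> f x \<le> max_on S f"
proof -
  obtain y where y: "y \<in> S" "\<And>x. x \<in> S \<Longrightarrow> f x \<le> f y"
    using continuous_attains_sup[OF assms] by blast
  have "max_on S f = f y"
    unfolding max_on_def by (rule Greatest_equality) (use y in auto)
  then show "max_on S f \<in> f ` S" "x \<in> S \<Longrightarrow> f x \<le> max_on S f"
    using y by auto
qed

locale periodic_kernel =
  fixes A :: "'a::complex_banach \<Rightarrow>\<^sub>L 'a" and \<omega> :: real and c :: complex
  assumes A: "A \<in> complex_operators" and \<omega>: "\<omega> > 0"
    and inverse: "(c *\<^sub>C id_blinfun - op_exp (\<omega> *\<^sub>R A)) o\<^sub>L
      op_inverse (c *\<^sub>C id_blinfun - op_exp (\<omega> *\<^sub>R A)) = id_blinfun"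
begin

definition E :: "real \<Rightarrow> 'a \<Rightarrow>\<^sub>L 'a" where
  "E t = op_exp (t *\<^sub>R A)"

definition V :: "'a \<Rightarrow>\<^sub>L 'a" where
  "V = op_inverse (c *\<^sub>C id_blinfun - op_exp (\<omega> *\<^sub>R A))"

text \<open>For \<open>s \<le> t\<close> and \<open>s > t\<close>, respectively, \<open>K(t,s) h(s)\<close> is \<open>e\<^bsup>At\<^esup>\<close> applied to \<open>p h s\<close> and \<open>q h s\<close>.\<close>

definition p :: "(real \<Rightarrow> 'a) \<Rightarrow> real \<Rightarrow> 'a" where
  "p h s = c *\<^sub>C E (- s) (V (h s))"

definition q :: "(real \<Rightarrow> 'a) \<Rightarrow> real \<Rightarrow> 'a" where
  "q h s = E (\<omega> - s) (V (h s))"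

text \<open>The Green operator of the linear problem y' = A y + h, y(\<omega>) = c y(0). The
  nonlinearity enters later through \<open>h\<close>.\<close>

definition J :: "(real \<Rightarrow> 'a) \<Rightarrow> real \<Rightarrow> 'a" where
  "J h t = integral {0..\<omega>} (\<lambda>s. kernel_K A \<omega> c t s (h s))"

lemma E_scaleC: "E t (z *\<^sub>C x) = z *\<^sub>C E t x"
  unfolding E_def by (rule complex_operators_scaleC[OF op_exp_complex_operators[OF A]])

lemma E_E: "E s (E t x) = E (s + t) x"
  by (simp add: E_def op_exp_add)

lemma E_0: "E 0 x = x"
  using op_exp_scaleR_0[of A] by (simp add: E_def)

lemma resolvent_identity: "c *\<^sub>C V x - E \<omega> (V x) = x"
proof -
  have "((c *\<^sub>C id_blinfun - op_exp (\<omega> *\<^sub>R A)) o\<^sub>L V) x = x"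
    unfolding V_def inverse by simp
  then show ?thesis
    by (simp add: E_def blinfun.diff_left blinfun_scaleC_apply)
qed

lemma continuous_on_E: "continuous_on X (\<lambda>t. E (f t))" if "continuous_on X f" for f :: "'b::topological_space \<Rightarrow> real"
  unfolding E_def by (rule continuous_on_compose2[OF continuous_on_op_exp that]) (rule subset_UNIV)

lemma continuous_on_E_V:
  assumes "continuous_on X f" "continuous_on X h"
  shows "continuous_on X (\<lambda>t. E (f t) (V (h t)))"
  by (intro blinfun.continuous_on continuous_on_E continuous_on_const assms)

lemma kernel_K_apply:
  "kernel_K A \<omega> c t s x = (if s \<le> t then c *\<^sub>C E (t - s) (V x) else E (\<omega> + t - s) (V x))"
  by (simp add: kernel_K_def E_def V_def blinfun_scaleC_apply)

lemma continuous_on_p: "continuous_on X h \<Longrightarrow> continuous_on X (p h)"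
  unfolding p_def
  by (intro bounded_linear.continuous_on[OF bounded_linear_scaleC] continuous_on_E_V
      continuous_on_minus continuous_on_id)

lemma continuous_on_q: "continuous_on X h \<Longrightarrow> continuous_on X (q h)"
  unfolding q_def
  by (intro continuous_on_E_V continuous_on_diff continuous_on_const continuous_on_id)

lemma J_has_integral:
  assumes h: "continuous_on {0..\<omega>} h" and t: "t \<in> {0..\<omega>}"
  shows "((\<lambda>s. kernel_K A \<omega> c t s (h s)) has_integral
    E t (integral {0..t} (p h) + integral {t..\<omega>} (q h))) {0..\<omega>}"
proof -
  have "(p h has_integral integral {0..t} (p h)) {0..t}"
    using t by (intro integrable_integral integrable_continuous_real continuous_on_p continuous_on_subset[OF h]) auto
  then have "((\<lambda>s. E t (p h s)) has_integral E t (integral {0..t} (p h))) {0..t}"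
    using has_integral_linear[OF _ blinfun.bounded_linear_right, of "p h" _ "{0..t}" "E t"] by (simp add: o_def)
  then have 1: "((\<lambda>s. kernel_K A \<omega> c t s (h s)) has_integral E t (integral {0..t} (p h))) {0..t}"
    by (rule has_integral_eq[rotated]) (simp add: kernel_K_apply p_def E_scaleC E_E)
  have "(q h has_integral integral {t..\<omega>} (q h)) {t..\<omega>}"
    using t by (intro integrable_integral integrable_continuous_real continuous_on_q continuous_on_subset[OF h]) auto
  then have "((\<lambda>s. E t (q h s)) has_integral E t (integral {t..\<omega>} (q h))) {t..\<omega>}"
    using has_integral_linear[OF _ blinfun.bounded_linear_right, of "q h" _ "{t..\<omega>}" "E t"] by (simp add: o_def)
  \<comment> \<open>At \<open>s = t\<close> the kernel takes its first branch, so the two integrands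
    may differ at that single point.\<close>
  then have 2: "((\<lambda>s. kernel_K A \<omega> c t s (h s)) has_integral E t (integral {t..\<omega>} (q h))) {t..\<omega>}"
    by (rule has_integral_spike_finite[rotated 2, of _ _ _ "{t}"])
       (auto simp: kernel_K_apply q_def E_E algebra_simps)
  show ?thesis
    unfolding blinfun.add_right by (rule has_integral_combine[OF _ _ 1 2]) (use t in auto)
qed

lemma J_eq:
  assumes "continuous_on {0..\<omega>} h" "t \<in> {0..\<omega>}"
  shows "J h t = E t (integral {0..t} (p h) + integral {t..\<omega>} (q h))"
  unfolding J_def by (rule integral_unique[OF J_has_integral[OF assms]])

lemma J_has_vector_derivative:
  assumes h: "continuous_on {0..\<omega>} h" and t: "t \<in> {0..\<omega>}"
  shows "(J h has_vector_derivative A (J h t) + h t) (at t within {0..\<omega>})"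
proof -
  let ?I = "\<lambda>t. integral {0..t} (p h) + integral {t..\<omega>} (q h)"
  have I: "(?I has_vector_derivative p h t + - q h t) (at t within {0..\<omega>})"
    by (intro has_vector_derivative_add integral_has_vector_derivative integral_has_vector_derivative'
        continuous_on_p continuous_on_q h t)
  have E: "(E has_vector_derivative (A o\<^sub>L E t)) (at t within {0..\<omega>})"
    unfolding E_def by (rule has_vector_derivative_at_within[OF op_exp_has_vector_derivative])
  have "((\<lambda>t. E t (?I t)) has_vector_derivative E t (p h t + - q h t) + (A o\<^sub>L E t) (?I t)) (at t within {0..\<omega>})"
    by (rule bounded_bilinear.has_vector_derivative[OF bounded_bilinear_blinfun_apply E I])
  moreover have "E t (p h t + - q h t) + (A o\<^sub>L E t) (?I t) = A (J h t) + h t"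
  proof -
    \<comment> \<open>The moving limits of integration contribute \<open>p h t - q h t\<close>;
      after applying \<open>E t\<close> the resolvent identity evaluates it to
      \<open>h t\<close>.\<close>
    have "E t (p h t + - q h t) = c *\<^sub>C V (h t) - E \<omega> (V (h t))"
      by (simp add: blinfun.diff_right p_def q_def E_scaleC E_E E_0)
    then show ?thesis
      by (simp add: resolvent_identity J_eq[OF h t])
  qed
  ultimately have "((\<lambda>t. E t (?I t)) has_vector_derivative A (J h t) + h t) (at t within {0..\<omega>})"
    by simp
  then show ?thesis
    by (rule has_vector_derivative_transform[OF t, rotated]) (rule J_eq[OF h])
qed

text \<open>At \<omega> only the integral of \<open>p\<close> remains and at 0 only that of
  \<open>q\<close>, and \<open>E \<omega>\<close> maps \<open>p h s\<close> to
  \<open>c *\<^sub>C q h s\<close>.\<close>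

lemma J_periodic:
  assumes h: "continuous_on {0..\<omega>} h"
  shows "J h \<omega> = c *\<^sub>C J h 0"
proof -
  have "J h \<omega> = E \<omega> (integral {0..\<omega>} (p h))"
    using J_eq[OF h, of \<omega>] \<omega> by simp
  also have "\<dots> = integral {0..\<omega>} (\<lambda>s. E \<omega> (p h s))"
    using integral_linear[OF integrable_continuous_real[OF continuous_on_p[OF h]] blinfun.bounded_linear_right, of "E \<omega>"]
    by (simp add: o_def)
  also have "(\<lambda>s. E \<omega> (p h s)) = (\<lambda>s. c *\<^sub>C q h s)"
    by (simp add: p_def q_def E_scaleC E_E)
  also have "integral {0..\<omega>} (\<lambda>s. c *\<^sub>C q h s) = c *\<^sub>C integral {0..\<omega>} (q h)"
    using integral_linear[OF integrable_continuous_real[OF continuous_on_q[OF h]] bounded_linear_scaleC, of c]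
    by (simp add: o_def)
  also have "\<dots> = c *\<^sub>C J h 0"
    using J_eq[OF h, of 0] \<omega> by (simp add: E_0)
  finally show ?thesis .
qed

text \<open>The norm of the kernel is |c| k(t - s) for s \<le> t and k(\<omega> + t - s)
  otherwise.\<close>

definition k :: "real \<Rightarrow> real" where
  "k u = norm (E u o\<^sub>L V)"

lemma continuous_on_k: "continuous_on X k"
  unfolding k_def
  by (intro continuous_on_norm bounded_bilinear.continuous_on[OF bounded_bilinear_blinfun_compose]
      continuous_on_E continuous_on_const continuous_on_id)

text \<open>Each branch of the kernel norm is, up to the factor |c|, \<open>k\<close> reflected in
  its own interval, \<open>{0..t}\<close> or \<open>{t..\<omega>}\<close>. The reflection leaves
  \<open>t\<close> only in the limits of integration.\<close>

lemma integral_reflect_k: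
  assumes "a \<le> b"
  shows "((\<lambda>s. k (a + b - s)) has_integral integral {a..b} k) {a..b}"
proof -
  have "(k has_integral integral {a..b} k) {a..b}"
    by (intro integrable_integral integrable_continuous_real continuous_on_k)
  then have "((\<lambda>s. k (- 1 * s + (a + b))) has_integral integral {a..b} k) ((\<lambda>x. (a + b) - x) ` {a..b})"
    using has_integral_affinity[of k _ a b "-1" "a + b"] by (simp add: algebra_simps image_affinity_atLeastAtMost)
  moreover have "(\<lambda>x. (a + b) - x) ` {a..b} = {a..b}"
    using assms by (auto simp: image_iff intro!: bexI[of _ "a + b - x" for x])
  ultimately show ?thesis
    by (simp add: algebra_simps)
qed

lemma norm_kernel_K_has_integral:
  assumes t: "t \<in> {0..\<omega>}"
  shows "((\<lambda>s. norm (kernel_K A \<omega> c t s)) has_integral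
    cmod c * integral {0..t} k + integral {t..\<omega>} k) {0..\<omega>}"
proof -
  have "((\<lambda>s. cmod c * k (0 + t - s)) has_integral cmod c * integral {0..t} k) {0..t}"
    using t by (intro has_integral_mult_right integral_reflect_k) auto
  then have 1: "((\<lambda>s. norm (kernel_K A \<omega> c t s)) has_integral cmod c * integral {0..t} k) {0..t}"
    by (rule has_integral_eq[rotated]) (simp add: kernel_K_def k_def E_def V_def norm_scaleC)
  have "((\<lambda>s. k (t + \<omega> - s)) has_integral integral {t..\<omega>} k) {t..\<omega>}"
    using t by (intro integral_reflect_k) auto
  then have 2: "((\<lambda>s. norm (kernel_K A \<omega> c t s)) has_integral integral {t..\<omega>} k) {t..\<omega>}"
    by (rule has_integral_spike_finite[rotated 2, of _ _ _ "{t}"])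
       (auto simp: kernel_K_def k_def E_def V_def add.commute)
  show ?thesis
    by (rule has_integral_combine[OF _ _ 1 2]) (use t in auto)
qed

text \<open>The integral depends continuously on \<open>t\<close>, which makes
  \<open>kernel_M\<close> an attained maximum.\<close>

lemma integral_norm_kernel_K_le:
  assumes t: "t \<in> {0..\<omega>}"
  shows "integral {0..\<omega>} (\<lambda>s. norm (kernel_K A \<omega> c t s)) \<le> kernel_M A \<omega> c"
  unfolding kernel_M_def
proof (rule le_max_on[OF _ _ _ t])
  have k: "k integrable_on {0..\<omega>}"
    by (intro integrable_continuous_real continuous_on_k)
  have "continuous_on {0..\<omega>} (\<lambda>t. cmod c * integral {0..t} k + integral {t..\<omega>} k)"
    by (intro continuous_on_add continuous_on_mult_left indefinite_integral_continuous_1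
        indefinite_integral_continuous_1' k)
  then show "continuous_on {0..\<omega>} (\<lambda>t. integral {0..\<omega>} (\<lambda>s. norm (kernel_K A \<omega> c t s)))"
    by (rule continuous_on_eq) (simp add: integral_unique[OF norm_kernel_K_has_integral])
qed (use \<omega> in auto)

lemma kernel_M_nonneg: "0 \<le> kernel_M A \<omega> c"
proof -
  have "0 \<in> {0..\<omega>}"
    using \<omega> by simp
  then have "0 \<le> integral {0..\<omega>} (\<lambda>s. norm (kernel_K A \<omega> c 0 s))"
    using norm_kernel_K_has_integral[of 0] by (intro integral_nonneg) (auto simp: has_integral_iff)
  then show ?thesis
    using integral_norm_kernel_K_le[OF \<open>0 \<in> _\<close>] by linarith
qed

lemma norm_J_le:
  assumes h: "continuous_on {0..\<omega>} h" and t: "t \<in> {0..\<omega>}"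
    and H: "\<And>s. s \<in> {0..\<omega>} \<Longrightarrow> norm (h s) \<le> H"
  shows "norm (J h t) \<le> kernel_M A \<omega> c * H"
proof -
  have H0: "0 \<le> H"
    using order_trans[OF norm_ge_zero H[OF t]] .
  have i: "((\<lambda>s. norm (kernel_K A \<omega> c t s) * H) has_integral
      (cmod c * integral {0..t} k + integral {t..\<omega>} k) * H) {0..\<omega>}"
    by (intro has_integral_mult_left norm_kernel_K_has_integral t)
  have "norm (J h t) \<le> integral {0..\<omega>} (\<lambda>s. norm (kernel_K A \<omega> c t s) * H)"
    unfolding J_def
  proof (rule integral_norm_bound_integral)
    show "(\<lambda>s. kernel_K A \<omega> c t s (h s)) integrable_on {0..\<omega>}"
      using J_has_integral[OF h t] by (rule has_integral_integrable)
    show "(\<lambda>s. norm (kernel_K A \<omega> c t s) * H) integrable_on {0..\<omega>}"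
      using i by (rule has_integral_integrable)
    show "norm (kernel_K A \<omega> c t s (h s)) \<le> norm (kernel_K A \<omega> c t s) * H" if "s \<in> {0..\<omega>}" for s
      by (rule order_trans[OF norm_blinfun mult_left_mono[OF H[OF that] norm_ge_zero]])
  qed
  also have "\<dots> = integral {0..\<omega>} (\<lambda>s. norm (kernel_K A \<omega> c t s)) * H"
    using i norm_kernel_K_has_integral[OF t] by (simp add: integral_unique)
  also have "\<dots> \<le> kernel_M A \<omega> c * H"
    by (rule mult_right_mono[OF integral_norm_kernel_K_le[OF t] H0])
  finally show ?thesis .
qed

lemma J_diff:
  assumes "continuous_on {0..\<omega>} h" "continuous_on {0..\<omega>} h'" "t \<in> {0..\<omega>}"
  shows "J h t - J h' t = J (\<lambda>s. h s - h' s) t"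
  unfolding J_def blinfun.diff_right
  by (intro integral_diff[symmetric] has_integral_integrable[OF J_has_integral] assms)

end

section \<open>Compact sets of Lipschitz functions\<close>

text \<open>The nearest-point retraction onto the interval: composing with it extends a function to
  the line without enlarging its bound or its Lipschitz constant.\<close>

definition clamp_to :: "real \<Rightarrow> real \<Rightarrow> real" where
  "clamp_to \<omega> t = max 0 (min \<omega> t)"

lemma clamp_to_in: "0 \<le> \<omega> \<Longrightarrow> clamp_to \<omega> t \<in> {0..\<omega>}"
  by (auto simp: clamp_to_def)

lemma clamp_to_id: "t \<in> {0..\<omega>} \<Longrightarrow> clamp_to \<omega> t = t"
  by (auto simp: clamp_to_def)

lemma clamp_to_Lipschitz: "\<bar>clamp_to \<omega> s - clamp_to \<omega> t\<bar> \<le> \<bar>s - t\<bar>"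
  by (auto simp: clamp_to_def max_def min_def)

text \<open>The space \<open>C([0, \<omega>], X)\<close> is represented inside \<^typ>\<open>real \<Rightarrow>\<^sub>C 'a\<close> by the functions that are
  constant on each side of \<open>[0, \<omega>]\<close>.\<close>

definition Lipschitz_functions :: "real \<Rightarrow> real \<Rightarrow> 'a set \<Rightarrow> (real \<Rightarrow>\<^sub>C 'a::metric_space) set" where
  "Lipschitz_functions \<omega> L C = {z. (\<forall>t. apply_bcontfun z t \<in> C) \<and> (\<forall>s t. dist (z s) (z t) \<le> L * \<bar>s - t\<bar>) \<and>
    (\<forall>t. z t = z (clamp_to \<omega> t))}"

lemma continuous_on_eval_bcontfun: "continuous_on X (\<lambda>z :: real \<Rightarrow>\<^sub>C 'a::metric_space. z t)"
  unfolding continuous_on_iff using dist_bounded le_less_trans by blast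

lemma closed_Lipschitz_functions:
  fixes C :: "'a::metric_space set"
  assumes "closed C"
  shows "closed (Lipschitz_functions \<omega> L C)"
proof -
  have 1: "closed {z :: real \<Rightarrow>\<^sub>C 'a. z t \<in> C}" for t
    using closed_vimage[OF assms continuous_on_eval_bcontfun[of UNIV t]] by (simp add: vimage_def)
  have 2: "closed {z :: real \<Rightarrow>\<^sub>C 'a. dist (z s) (z t) \<le> L * \<bar>s - t\<bar>}" for s t
    by (intro closed_Collect_le continuous_on_dist continuous_on_eval_bcontfun continuous_on_const)
  have 3: "closed {z :: real \<Rightarrow>\<^sub>C 'a. dist (z t) (z (clamp_to \<omega> t)) \<le> 0}" for t
    by (intro closed_Collect_le continuous_on_dist continuous_on_eval_bcontfun continuous_on_const)
  have "Lipschitz_functions \<omega> L C = (\<Inter>t. {z :: real \<Rightarrow>\<^sub>C 'a. z t \<in> C}) \<inter>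
    (\<Inter>s. \<Inter>t. {z :: real \<Rightarrow>\<^sub>C 'a. dist (z s) (z t) \<le> L * \<bar>s - t\<bar>}) \<inter>
    (\<Inter>t. {z :: real \<Rightarrow>\<^sub>C 'a. dist (z t) (z (clamp_to \<omega> t)) \<le> 0})"
    by (auto simp: Lipschitz_functions_def)
  also have "closed \<dots>"
    by (intro closed_Int closed_INT ballI 1 2 3)
  finally show ?thesis .
qed

text \<open>Arzela--Ascoli: the pointwise limit on the rationals exists by Tychonoff's theorem.\<close>

lemma compact_Lipschitz_functions:
  fixes C :: "'a::complete_space set"
  assumes C: "compact C" and L: "0 \<le> L" and \<omega>: "0 \<le> \<omega>"
  shows "compact (Lipschitz_functions \<omega> L C)"
  unfolding compact_eq_seq_compact_metric seq_compact_def
proof (intro allI impI)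
  fix f :: "nat \<Rightarrow> real \<Rightarrow>\<^sub>C 'a"
  assume f: "\<forall>n. f n \<in> Lipschitz_functions \<omega> L C"
  have lip: "dist (f n s) (f n t) \<le> L * \<bar>s - t\<bar>" and f_clamp: "f n t = f n (clamp_to \<omega> t)" for n s t
    using f by (auto simp: Lipschitz_functions_def)
  \<comment> \<open>A countable index set keeps the product metrizable, so compactness yields a
    convergent subsequence.\<close>
  define u where "u n r = f n (real_of_rat r)" for n r
  have "compact (PiE UNIV (\<lambda>_ :: rat. C))"
    by (rule compact_PiE_UNIV[OF C])
  moreover have "\<forall>n. u n \<in> PiE UNIV (\<lambda>_ :: rat. C)"
    using f by (auto simp: u_def Lipschitz_functions_def)
  ultimately obtain l \<phi> where \<phi>: "strict_mono \<phi>" "(u \<circ> \<phi>) \<longlonglongrightarrow> l"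
    unfolding compact_eq_seq_compact_metric seq_compact_def by metis
  have pointwise: "(\<lambda>n. f (\<phi> n) (real_of_rat r)) \<longlonglongrightarrow> l r" for r
  proof -
    have "isCont (\<lambda>v :: rat \<Rightarrow> 'a. v r) l"
      by (rule continuous_on_interior[OF continuous_on_product_coordinates]) simp
    from isCont_tendsto_compose[OF this \<phi>(2)] show ?thesis
      by (simp add: u_def o_def)
  qed
  have "Cauchy (f \<circ> \<phi>)"
    unfolding Cauchy_altdef2
  proof (intro allI impI)
    fix e :: real assume e: "e > 0"
    \<comment> \<open>Passing to a rational within \<open>d\<close> costs \<open>e / 8\<close>. Two
      such passages and two distances to the limit add up to \<open>e / 2\<close>; the summand 1
      allows for \<open>L = 0\<close>.\<close>
    define d where "d = e / (8 * (L + 1))"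
    have d: "d > 0" "L * d \<le> e / 8"
      using L e by (auto simp: d_def field_simps)
    have "{0..\<omega>} \<subseteq> (\<Union>r. ball (real_of_rat r) d)"
    proof
      fix t :: real
      obtain r where "t - d < real_of_rat r" "real_of_rat r < t"
        using of_rat_dense[of "t - d" t] d by auto
      then have "t \<in> ball (real_of_rat r) d"
        by (simp add: dist_real_def)
      then show "t \<in> (\<Union>r. ball (real_of_rat r) d)"
        by (rule UN_I[OF UNIV_I])
    qed
    then obtain G where G: "finite G" "{0..\<omega>} \<subseteq> (\<Union>r\<in>G. ball (real_of_rat r) d)"
      using compactE_image[OF compact_Icc, of UNIV "\<lambda>r. ball (real_of_rat r) d" 0 \<omega>] by auto
    have "\<forall>\<^sub>F n in sequentially. \<forall>r\<in>G. dist (f (\<phi> n) (real_of_rat r)) (l r) < e / 8"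
      using e by (intro eventually_ball_finite G ballI tendstoD[OF pointwise]) simp
    then obtain N where N: "\<And>n r. n \<ge> N \<Longrightarrow> r \<in> G \<Longrightarrow> dist (f (\<phi> n) (real_of_rat r)) (l r) < e / 8"
      unfolding eventually_sequentially by blast
    have close: "dist (f (\<phi> n)) (f (\<phi> N)) \<le> e / 2" if n: "n \<ge> N" for n
    proof (rule dist_bound)
      fix t
      \<comment> \<open>Clamping reduces all real \<open>t\<close> to the interval covered by the
        finite net.\<close>
      define s where "s = clamp_to \<omega> t"
      obtain r where r: "r \<in> G" "\<bar>s - real_of_rat r\<bar> < d"
        using clamp_to_in[OF \<omega>, of t] G(2) by (force simp: s_def dist_real_def)
      have near: "dist (f m s) (f m (real_of_rat r)) \<le> e / 8" for m
        using lip[of m s "real_of_rat r"] mult_left_mono[OF less_imp_le[OF r(2)] L] d(2) by linarith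
      have "dist (f (\<phi> n) s) (f (\<phi> N) s) \<le> e / 2"
        using near[of "\<phi> n"] near[of "\<phi> N"] N[OF n r(1)] N[OF order_refl r(1)]
          dist_triangle[of "f (\<phi> n) s" "f (\<phi> N) s" "f (\<phi> n) (real_of_rat r)"]
          dist_triangle[of "f (\<phi> n) (real_of_rat r)" "f (\<phi> N) s" "f (\<phi> N) (real_of_rat r)"]
          dist_triangle2[of "f (\<phi> n) (real_of_rat r)" "f (\<phi> N) (real_of_rat r)" "l r"]
        by (simp add: dist_commute)
      then show "dist (f (\<phi> n) t) (f (\<phi> N) t) \<le> e / 2"
        unfolding s_def by (simp only: f_clamp[of _ t, symmetric])
    qed
    have "dist ((f \<circ> \<phi>) n) ((f \<circ> \<phi>) N) < e" if "n \<ge> N" for n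
      using close[OF that] e by simp
    then show "\<exists>N. \<forall>n\<ge>N. dist ((f \<circ> \<phi>) n) ((f \<circ> \<phi>) N) < e"
      by blast
  qed
  then obtain z where z: "(f \<circ> \<phi>) \<longlonglongrightarrow> z"
    using Cauchy_convergent convergent_def by blast
  moreover have "z \<in> Lipschitz_functions \<omega> L C"
    by (rule closed_sequentially[OF closed_Lipschitz_functions[OF compact_imp_closed[OF C]] _ z]) (simp add: f)
  ultimately show "\<exists>l\<in>Lipschitz_functions \<omega> L C. \<exists>r. strict_mono r \<and> (f \<circ> r) \<longlonglongrightarrow> l"
    using \<phi> by blast
qed

lemma convex_Lipschitz_functions:
  fixes C :: "'a::real_normed_vector set"
  assumes "convex C"
  shows "convex (Lipschitz_functions \<omega> L C)"
proof (rule convexI)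
  fix y z :: "real \<Rightarrow>\<^sub>C 'a" and a b :: real
  assume y: "y \<in> Lipschitz_functions \<omega> L C" and z: "z \<in> Lipschitz_functions \<omega> L C"
    and ab: "0 \<le> a" "0 \<le> b" "a + b = 1"
  have ev: "(a *\<^sub>R y + b *\<^sub>R z) t = a *\<^sub>R y t + b *\<^sub>R z t" for t
    by (simp add: plus_bcontfun.rep_eq scaleR_bcontfun.rep_eq)
  have "norm ((a *\<^sub>R y + b *\<^sub>R z) s - (a *\<^sub>R y + b *\<^sub>R z) t) \<le> L * \<bar>s - t\<bar>" for s t
  proof -
    have "(a *\<^sub>R y + b *\<^sub>R z) s - (a *\<^sub>R y + b *\<^sub>R z) t = a *\<^sub>R (y s - y t) + b *\<^sub>R (z s - z t)"
      by (simp add: ev scaleR_diff_right)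
    also have "norm \<dots> \<le> a * norm (y s - y t) + b * norm (z s - z t)"
      using norm_triangle_ineq[of "a *\<^sub>R (y s - y t)" "b *\<^sub>R (z s - z t)"] ab by simp
    also have "\<dots> \<le> a * (L * \<bar>s - t\<bar>) + b * (L * \<bar>s - t\<bar>)"
      using y z ab by (intro add_mono mult_left_mono) (auto simp: Lipschitz_functions_def dist_norm)
    also have "\<dots> = L * \<bar>s - t\<bar>"
      using ab by (simp flip: distrib_right)
    finally show ?thesis .
  qed
  moreover have "(a *\<^sub>R y + b *\<^sub>R z) t \<in> C" for t
    using convexD[OF assms] y z ab by (simp add: ev Lipschitz_functions_def)
  moreover have "(a *\<^sub>R y + b *\<^sub>R z) t = (a *\<^sub>R y + b *\<^sub>R z) (clamp_to \<omega> t)" for t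
  proof -
    have "y t = y (clamp_to \<omega> t)" "z t = z (clamp_to \<omega> t)"
      using y z unfolding Lipschitz_functions_def by blast+
    then show ?thesis
      unfolding ev by simp
  qed
  ultimately show "a *\<^sub>R y + b *\<^sub>R z \<in> Lipschitz_functions \<omega> L C"
    unfolding Lipschitz_functions_def dist_norm by blast
qed

lemma vector_derivative_Lipschitz:
  fixes f :: "real \<Rightarrow> 'a::real_normed_vector"
  assumes "convex S" "\<And>t. t \<in> S \<Longrightarrow> (f has_vector_derivative f' t) (at t within S)"
    and "\<And>t. t \<in> S \<Longrightarrow> norm (f' t) \<le> L" and "s \<in> S" "t \<in> S"
  shows "norm (f s - f t) \<le> L * \<bar>s - t\<bar>"
proof -
  have "norm (f s - f t) \<le> L * norm (s - t)"
  proof (rule differentiable_bound[OF assms(1) _ _ assms(4,5), of f "\<lambda>t h. h *\<^sub>R f' t"])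
    show "onorm (\<lambda>h. h *\<^sub>R f' t) \<le> L" if "t \<in> S" for t
    proof (rule onorm_bound)
      show "0 \<le> L"
        by (rule order_trans[OF norm_ge_zero assms(3)[OF that]])
      show "norm (h *\<^sub>R f' t) \<le> L * norm h" for h
        using mult_left_mono[OF assms(3)[OF that] abs_ge_zero[of h]] by (simp add: mult.commute)
    qed
  qed (use assms(2) in \<open>auto simp: has_vector_derivative_def\<close>)
  then show ?thesis
    by simp
qed

section \<open>Existence of a periodic solution\<close>

context periodic_kernel
begin

lemma ex_fixpoint:
  fixes g :: "real \<Rightarrow> 'a \<Rightarrow> 'a"
  assumes fin: "finite_cdim TYPE('a)"
    and contg: "continuous_on UNIV (\<lambda>(t, y). g t y)"
    and g12: "g1 \<ge> 0" "g2 \<ge> 0" and growth: "\<And>t y. norm (g t y) \<le> g1 + g2 * norm y"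
    and small: "g2 * kernel_M A \<omega> c < 1"
  defines "R \<equiv> kernel_M A \<omega> c * g1 / (1 - kernel_M A \<omega> c * g2)"
  obtains z where "\<And>t. t \<in> {0..\<omega>} \<Longrightarrow> (z has_vector_derivative A (z t) + g t (z t)) (at t within {0..\<omega>})"
    "z \<omega> = c *\<^sub>C z 0" "\<And>t. t \<in> {0..\<omega>} \<Longrightarrow> norm (z t) \<le> R"
proof -
  let ?M = "kernel_M A \<omega> c"
  have R: "0 \<le> R"
    unfolding R_def using kernel_M_nonneg g12 small by (auto simp: mult.commute)
  have fix_R: "?M * (g1 + g2 * R) = R"
    unfolding R_def using small by (simp add: field_simps)
  define H where "H = g1 + g2 * R"
  define L where "L = norm A * R + H"
  have H: "0 \<le> H" and L: "0 \<le> L"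
    using g12 R by (auto simp: H_def L_def)
  define S where "S = Lipschitz_functions \<omega> L (cball (0::'a) R)"
  define h where "h z s = g s (apply_bcontfun z s)" for z s
  \<comment> \<open>The clamp places the image of the integral operator among functions constant on
    each side of the interval.\<close>
  define f where "f z t = J (h z) (clamp_to \<omega> t)" for z t
  have S_R: "norm (apply_bcontfun z t) \<le> R" if "z \<in> S" for z t
    using that by (simp add: S_def Lipschitz_functions_def)
  have conth: "continuous_on {0..\<omega>} (h z)" for z
    using continuous_on_compose2[OF contg, of "{0..\<omega>}" "\<lambda>s. (s, apply_bcontfun z s)"]
    by (simp add: h_def continuous_on_Pair)
  have hH: "norm (h z s) \<le> H" if "z \<in> S" for z s
    using growth[of s "z s"] mult_left_mono[OF S_R[OF that, of s] g12(2)] by (simp add: h_def H_def)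
  have JR: "norm (J (h z) t) \<le> R" if "z \<in> S" "t \<in> {0..\<omega>}" for z t
    using norm_J_le[OF conth that(2) hH[OF that(1)]] fix_R by (simp add: H_def)
  have J_Lipschitz: "norm (J (h z) s - J (h z) t) \<le> L * \<bar>s - t\<bar>"
    if z: "z \<in> S" and "s \<in> {0..\<omega>}" "t \<in> {0..\<omega>}" for z s t
  proof (rule vector_derivative_Lipschitz[OF _ J_has_vector_derivative[OF conth] _ that(2,3)])
    show "norm (A (J (h z) t) + h z t) \<le> L" if "t \<in> {0..\<omega>}" for t
      using norm_triangle_ineq[of "A (J (h z) t)" "h z t"] norm_blinfun[of A "J (h z) t"]
        mult_left_mono[OF JR[OF z that] norm_ge_zero[of A]] hH[OF z, of t]
      by (simp add: L_def)
  qed simp_all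
  have f_Lipschitz: "norm (f z s - f z t) \<le> L * \<bar>s - t\<bar>" if "z \<in> S" for z s t
    using J_Lipschitz[OF that clamp_to_in clamp_to_in, of s t] mult_left_mono[OF clamp_to_Lipschitz L, of \<omega> s t] \<omega>
    by (simp add: f_def)
  have f_bcontfun: "f z \<in> bcontfun" if "z \<in> S" for z
  proof (rule bcontfun_normI)
    have "L-lipschitz_on UNIV (f z)"
      using f_Lipschitz[OF that] L by (intro lipschitz_onI) (simp_all add: dist_norm)
    then show "continuous_on UNIV (f z)"
      by (rule lipschitz_on_continuous_on)
    show "norm (f z t) \<le> R" for t
      using JR[OF that clamp_to_in] \<omega> by (simp add: f_def)
  qed
  define T where "T z = Bcontfun (f z)" for z
  have T: "apply_bcontfun (T z) = f z" if "z \<in> S" for z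
    unfolding T_def by (rule Bcontfun_inverse[OF f_bcontfun[OF that]])
  have T_S: "T z \<in> S" if "z \<in> S" for z
  proof -
    have "f z t = f z (clamp_to \<omega> t)" for t
      using clamp_to_id[OF clamp_to_in, of \<omega> t] \<omega> by (simp add: f_def)
    then show ?thesis
      using f_Lipschitz[OF that] JR[OF that clamp_to_in] \<omega>
      by (simp add: S_def Lipschitz_functions_def T[OF that] dist_norm f_def)
  qed
  have cont_T: "continuous_on S T"
    unfolding continuous_on_iff
  proof (intro ballI allI impI)
    fix z and e :: real assume z: "z \<in> S" and e: "e > 0"
    \<comment> \<open>The summand 1 allows for \<open>?M = 0\<close> and makes the final inequality
      strict.\<close>
    define e' where "e' = e / (?M + 1)"
    have e': "e' > 0" "?M * e' < e"
      using e kernel_M_nonneg by (auto simp: e'_def field_simps)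
    \<comment> \<open>This set contains the graphs over \<open>{0..\<omega>}\<close> of all members
      of \<open>S\<close>; uniform continuity of \<open>g\<close> on it turns uniform closeness of
      \<open>z\<close> and \<open>z'\<close> into that of \<open>h z\<close> and
      \<open>h z'\<close>.\<close>
    have "compact ({0..\<omega>} \<times> cball (0::'a) R)"
      by (intro compact_Times compact_Icc compact_cball_finite_cdim fin)
    then have "uniformly_continuous_on ({0..\<omega>} \<times> cball (0::'a) R) (\<lambda>(t, y). g t y)"
      by (intro compact_uniformly_continuous continuous_on_subset[OF contg]) auto
    then obtain d where d: "d > 0" "\<And>p p'. p \<in> {0..\<omega>} \<times> cball 0 R \<Longrightarrow> p' \<in> {0..\<omega>} \<times> cball 0 R \<Longrightarrow>
        dist p' p < d \<Longrightarrow> dist (case p' of (t, y) \<Rightarrow> g t y) (case p of (t, y) \<Rightarrow> g t y) < e'"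
      unfolding uniformly_continuous_on_def using e'(1) by blast
    have "dist (T z') (T z) < e" if z': "z' \<in> S" "dist z' z < d" for z'
    proof -
      have hd: "norm (h z' s - h z s) \<le> e'" if "s \<in> {0..\<omega>}" for s
        using d(2)[of "(s, z s)" "(s, z' s)"] that S_R[OF z] S_R[OF z'(1)]
          le_less_trans[OF dist_bounded z'(2), of s]
        by (simp add: dist_Pair_Pair h_def dist_norm)
      have "dist (T z') (T z) \<le> ?M * e'"
      proof (rule dist_bound)
        fix t
        have t: "clamp_to \<omega> t \<in> {0..\<omega>}"
          using \<omega> by (intro clamp_to_in) simp
        have "norm (J (h z') (clamp_to \<omega> t) - J (h z) (clamp_to \<omega> t)) \<le> ?M * e'"
          unfolding J_diff[OF conth conth t]
          by (rule norm_J_le[OF continuous_on_diff[OF conth conth] t hd])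
        then show "dist (T z' t) (T z t) \<le> ?M * e'"
          by (simp add: T z z'(1) f_def dist_norm)
      qed
      then show ?thesis
        using e'(2) by simp
    qed
    then show "\<exists>d>0. \<forall>z'\<in>S. dist z' z < d \<longrightarrow> dist (T z') (T z) < e"
      using d(1) by blast
  qed
  have "compact S"
    unfolding S_def using \<omega> L by (intro compact_Lipschitz_functions compact_cball_finite_cdim fin) auto
  moreover have "convex S"
    unfolding S_def by (intro convex_Lipschitz_functions convex_cball)
  moreover have "const_bcontfun 0 \<in> S"
    using R L by (simp add: S_def Lipschitz_functions_def)
  then have "S \<noteq> {}"
    by blast
  ultimately obtain z where z: "z \<in> S" "T z = z"
    using Schauder_fixpoint[OF _ _ _ cont_T T_S] by blast
  have zJ: "z t = J (h z) t" if "t \<in> {0..\<omega>}" for t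
    using T[OF z(1)] z(2) clamp_to_id[OF that] by (simp add: f_def)
  show thesis
  proof
    fix t assume t: "t \<in> {0..\<omega>}"
    have "(J (h z) has_vector_derivative A (z t) + g t (z t)) (at t within {0..\<omega>})"
      using J_has_vector_derivative[OF conth t, of z] by (simp add: zJ[OF t, symmetric]) (simp add: h_def)
    then show "(apply_bcontfun z has_vector_derivative A (z t) + g t (z t)) (at t within {0..\<omega>})"
      by (rule has_vector_derivative_transform[OF t, rotated]) (rule zJ)
    show "norm (z t) \<le> R"
      by (rule S_R[OF z(1)])
  next
    show "z \<omega> = c *\<^sub>C z 0"
      using J_periodic[OF conth] zJ[of 0] zJ[of \<omega>] \<omega> by simp
  qed
qed

end

text \<open>By (i) and the linearity of \<open>A\<close> the equation is invariant under shifting by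
  \<omega> and dividing by \<open>c\<close>, so it is enough to verify it on one period, where only
  the left derivative at 0 has to be imported from the neighbouring one.\<close>

lemma periodic_extension:
  fixes A :: "'a::complex_normed_vector \<Rightarrow>\<^sub>L 'a"
  assumes A: "A \<in> complex_operators" and \<omega>: "\<omega> > 0" and c: "c \<noteq> 0"
    and g: "\<And>t y. g (t + \<omega>) (c *\<^sub>C y) = c *\<^sub>C g t y"
    and z: "\<And>t. t \<in> {0..\<omega>} \<Longrightarrow> (z has_vector_derivative A (z t) + g t (z t)) (at t within {0..\<omega>})"
    and z\<omega>: "z \<omega> = c *\<^sub>C z 0"
  shows "\<exists>y. (\<forall>t. (y has_vector_derivative A (y t) + g t (y t)) (at t)) \<and>
    omega_c_periodic \<omega> c y \<and> (\<forall>t\<in>{0..\<omega>}. y t = z t)"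
proof -
  \<comment> \<open>The shift law forces this formula; the exponent is an integer power since
    \<open>t\<close> may be negative.\<close>
  define y where "y t = (c powi \<lfloor>t / \<omega>\<rfloor>) *\<^sub>C z (t - of_int \<lfloor>t / \<omega>\<rfloor> * \<omega>)" for t
  have y_shift: "y (t + \<omega>) = c *\<^sub>C y t" for t
  proof -
    have fl: "\<lfloor>(t + \<omega>) / \<omega>\<rfloor> = \<lfloor>t / \<omega>\<rfloor> + 1"
      using \<omega> by (simp add: add_divide_distrib)
    have arg: "t + \<omega> - of_int (\<lfloor>t / \<omega>\<rfloor> + 1) * \<omega> = t - of_int \<lfloor>t / \<omega>\<rfloor> * \<omega>"
      by (simp add: algebra_simps)
    then show ?thesis
      unfolding y_def fl arg using c by (simp add: power_int_add scaleC_scaleC mult.commute)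
  qed
  have yz: "y t = z t" if t: "t \<in> {0..\<omega>}" for t
  proof (cases "t = \<omega>")
    \<comment> \<open>Here the floor is already 1 and the formula gives
      \<open>c *\<^sub>C z 0\<close>, which the boundary condition identifies with
      \<open>z \<omega>\<close>.\<close>
    case True
    then show ?thesis
      using \<omega> z\<omega> by (simp add: y_def)
  next
    case False
    then have "\<lfloor>t / \<omega>\<rfloor> = 0"
      using t \<omega> by (simp add: floor_eq_iff)
    then show ?thesis
      by (simp add: y_def scaleC_one)
  qed
  define D where "D t \<longleftrightarrow> (y has_vector_derivative A (y t) + g t (y t)) (at t)" for t
  have within: "(y has_vector_derivative A (y t) + g t (y t)) (at t within {0..\<omega>})" if "t \<in> {0..\<omega>}" for t
    using has_vector_derivative_transform[OF that yz z[OF that]] yz[OF that] by simp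
  \<comment> \<open>The set \<open>X\<close> is arbitrary so that one statement serves the one-sided
    derivative at 0 and the full derivatives elsewhere.\<close>
  have shift_deriv: "(y has_vector_derivative b *\<^sub>C (A (y (t + a)) + g (t + a) (y (t + a)))) (at t within X)"
    if "\<And>s. y s = b *\<^sub>C y (s + a)"
      and "(y has_vector_derivative A (y (t + a)) + g (t + a) (y (t + a))) (at (t + a) within (\<lambda>s. s + a) ` X)" for a b t X
  proof -
    have "(y \<circ> (\<lambda>s. s + a) has_vector_derivative 1 *\<^sub>R (A (y (t + a)) + g (t + a) (y (t + a)))) (at t within X)"
      by (rule vector_diff_chain_within[OF _ that(2)]) (auto intro!: derivative_eq_intros)
    from bounded_linear.has_vector_derivative[OF bounded_linear_scaleC this, of b]
    have "((\<lambda>s. b *\<^sub>C y (s + a)) has_vector_derivative b *\<^sub>C (A (y (t + a)) + g (t + a) (y (t + a)))) (at t within X)"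
      by (simp add: o_def)
    moreover have "(\<lambda>s. b *\<^sub>C y (s + a)) = y"
      using that(1) by (intro ext) (rule sym)
    ultimately show ?thesis
      by simp
  qed
  have up: "y s = c *\<^sub>C y (s + - \<omega>)" and down: "y s = inverse c *\<^sub>C y (s + \<omega>)" for s
    using y_shift[of "s - \<omega>"] y_shift[of s] c by (simp_all add: scaleC_scaleC scaleC_one)
  have rhs_shift: "A (y (t + \<omega>)) + g (t + \<omega>) (y (t + \<omega>)) = c *\<^sub>C (A (y t) + g t (y t))" for t
    by (simp add: y_shift complex_operators_scaleC[OF A] g scaleC_add_right)
  have rhs_down: "inverse c *\<^sub>C (A (y (t + \<omega>)) + g (t + \<omega>) (y (t + \<omega>))) = A (y t) + g t (y t)" for t
    unfolding rhs_shift using c by (simp add: scaleC_scaleC scaleC_one)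
  have D_down: "D t" if "D (t + \<omega>)" for t
    using shift_deriv[OF down, of t UNIV] that unfolding rhs_down D_def by (simp add: surj_plus_right)
  have D_up: "D (t + \<omega>)" if "D t" for t
    using shift_deriv[OF up, of "t + \<omega>" UNIV] that unfolding D_def rhs_shift by (simp add: surj_plus_right)
  \<comment> \<open>The left derivative at 0 is the one at \<omega>, shifted back by one
    period.\<close>
  have "(y has_vector_derivative A (y 0) + g 0 (y 0)) (at 0 within {-\<omega>..0})"
  proof -
    have "(\<lambda>s. s + \<omega>) ` {-\<omega>..0} = {0..\<omega>}"
      by simp
    then show ?thesis
      using shift_deriv[OF down, of 0 "{-\<omega>..0}"] within[of \<omega>] rhs_down[of 0] \<omega> by simp
  qed
  moreover have "(y has_vector_derivative A (y 0) + g 0 (y 0)) (at 0 within {0..\<omega>})"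
    using within[of 0] \<omega> by simp
  ultimately have "(y has_vector_derivative A (y 0) + g 0 (y 0)) (at 0 within {-\<omega>..0} \<union> {0..\<omega>})"
    unfolding has_vector_derivative_def has_derivative_within
    by (auto simp: at_within_union intro: filterlim_sup)
  moreover have "{-\<omega>..0} \<union> {0..\<omega>} = {-\<omega>..\<omega>}"
    using \<omega> by auto
  ultimately have "(y has_vector_derivative A (y 0) + g 0 (y 0)) (at 0 within {-\<omega>..\<omega>})"
    by simp
  then have D0: "D 0"
    unfolding D_def using \<omega> at_within_Icc_at[of "-\<omega>" 0 \<omega>] by simp
  have D_base: "D t" if "0 \<le> t" "t < \<omega>" for t
  proof (cases "t = 0")
    case False
    then show ?thesis
      using within[of t] that at_within_Icc_at[of 0 t \<omega>] by (simp add: D_def)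
  qed (simp add: D0)
  have D_int: "D (t + of_int i * \<omega>)" if "D t" for t i
  proof (induction i rule: int_induct[of _ 0])
    case (step1 i)
    have eq: "t + of_int (i + 1) * \<omega> = t + of_int i * \<omega> + \<omega>"
      by (simp add: algebra_simps)
    show ?case
      unfolding eq by (rule D_up[OF step1(2)])
  next
    case (step2 i)
    have eq: "t + of_int i * \<omega> = t + of_int (i - 1) * \<omega> + \<omega>"
      by (simp add: algebra_simps)
    show ?case
      by (rule D_down) (use step2(2) in \<open>simp only: eq\<close>)
  qed (simp add: that)
  have "D t" for t
  proof -
    define i where "i = \<lfloor>t / \<omega>\<rfloor>"
    have "of_int i \<le> t / \<omega>" "t / \<omega> < of_int i + 1"
      by (simp_all add: i_def)
    then have "of_int i * \<omega> \<le> t" "t < (of_int i + 1) * \<omega>"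
      by (simp_all only: pos_le_divide_eq[OF \<omega>] pos_divide_less_eq[OF \<omega>])
    then have "D (t - of_int i * \<omega>)"
      by (intro D_base) (simp_all add: algebra_simps)
    then show ?thesis
      using D_int[of "t - of_int i * \<omega>" i] by simp
  qed
  then show ?thesis
    using yz y_shift unfolding D_def omega_c_periodic_def by blast
qed

theorem theorem4p1:
  fixes A :: "'a::complex_banach \<Rightarrow>\<^sub>L 'a"
    and \<omega> :: real and c :: complex
    and g :: "real \<Rightarrow> 'a \<Rightarrow> 'a"
    and g1 g2 :: real
  assumes "finite_cdim TYPE('a)"
    and "A \<in> complex_operators"
    and "\<omega> > 0"
    and "c \<noteq> 0"
    and "\<forall>\<mu> \<in> op_spectrum A. c \<noteq> exp (complex_of_real \<omega> * \<mu>)"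
    and "continuous_on UNIV (\<lambda>(t, y). g t y)"
    and "\<forall>t y. g (t + \<omega>) (c *\<^sub>C y) = c *\<^sub>C g t y"
    and "g1 \<ge> 0" and "g2 \<ge> 0"
    and "\<forall>t y. norm (g t y) \<le> g1 + g2 * norm y"
    and "g2 * kernel_M A \<omega> c < 1"
  shows "\<exists>y :: real \<Rightarrow> 'a.
    (\<forall>t. (y has_vector_derivative (A (y t) + g t (y t))) (at t)) \<and>
    omega_c_periodic \<omega> c y \<and>
    norm0 \<omega> y \<le> kernel_M A \<omega> c * g1 / (1 - kernel_M A \<omega> c * g2)"
proof -
  interpret periodic_kernel A \<omega> c
    by unfold_locales (use assms op_inverse_exp_right[OF assms(1,2,5)] in auto)
  obtain z where z: "\<And>t. t \<in> {0..\<omega>} \<Longrightarrow> (z has_vector_derivative A (z t) + g t (z t)) (at t within {0..\<omega>})"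
    "z \<omega> = c *\<^sub>C z 0"
    "\<And>t. t \<in> {0..\<omega>} \<Longrightarrow> norm (z t) \<le> kernel_M A \<omega> c * g1 / (1 - kernel_M A \<omega> c * g2)"
    using ex_fixpoint[OF assms(1,6,8,9) _ assms(11)] assms(10) by metis
  have g: "g (t + \<omega>) (c *\<^sub>C y) = c *\<^sub>C g t y" for t y
    using assms(7) by blast
  obtain y where y: "\<forall>t. (y has_vector_derivative A (y t) + g t (y t)) (at t)"
    "omega_c_periodic \<omega> c y" "\<forall>t\<in>{0..\<omega>}. y t = z t"
    using periodic_extension[OF A \<omega> assms(4) g z(1,2)] by blast
  \<comment> \<open>Continuity makes \<open>norm0\<close> a value of \<open>norm (y t)\<close> on
    the interval, so the pointwise bound applies to it.\<close>
  have "continuous_on {0..\<omega>} y"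
    by (intro continuous_at_imp_continuous_on ballI has_vector_derivative_continuous[OF y(1)[rule_format]])
  then have "norm0 \<omega> y \<in> (\<lambda>t. norm (y t)) ` {0..\<omega>}"
    unfolding norm0_def using \<omega> by (intro max_on_in_image continuous_on_norm) auto
  then have "norm0 \<omega> y \<le> kernel_M A \<omega> c * g1 / (1 - kernel_M A \<omega> c * g2)"
    using y(3) z(3) by auto
  then show ?thesis
    using y(1,2) by blast
qed

end
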